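(* For a finite nilpotent group $G$, the cyclic graph $\Delta(G)$ is dominatable if and only if, for some prime $p$ dividing $|G|$, the Sylow $p$-subgroup of $G$ is cyclic or generalized quaternion.
   Context: For a group $G$, the cyclic graph $\Delta(G)$ is the simple graph whose vertex set is $G^{\#}=G\setminus\{1\}$, with an edge between distinct vertices $x,y$ if and only if the subgroup $\langle x,y\rangle$ is cyclic. A vertex $z$ of $\Delta(G)$ is a dominating vertex if $z$ is adjacent to every vertex other than $z$. The graph $\Delta(G)$ is dominatable if it has a dominating vertex. Generalized quaternion groups are those of order $2^n$, $n\ge 3$, including the quaternion group of order $8$. *)

theory Defs
  imports
    "HOL-Algebra.Elementary_Groups"
    "HOL-Algebra.Sylow"
    "Graph_Theory.Pair_Digraph"
begin

text \<open>A simple graph is rendered as a symmetric, loop-free pair digraph (locale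
  \<open>pair_graph\<close>): an undirected edge between \<open>x\<close> and \<open>y\<close> is the pair of arcs \<open>(x, y)\<close>, \<open>(y, x)\<close>.\<close>

definition cyclic_graph :: "('a, 'b) monoid_scheme \<Rightarrow> 'a pair_pre_digraph" where
  "cyclic_graph G =
    \<lparr> pverts = carrier G - {\<one>\<^bsub>G\<^esub>},
      parcs = {(x, y). x \<in> carrier G - {\<one>\<^bsub>G\<^esub>} \<and> y \<in> carrier G - {\<one>\<^bsub>G\<^esub>} \<and> x \<noteq> y \<and>
                       cyclic_group (subgroup_generated G {x, y})} \<rparr>"

lemma pair_graph_cyclic_graph:
  assumes "finite (carrier G)"
  shows "pair_graph (cyclic_graph G)"
proof
  show "finite (pverts (cyclic_graph G))"
    using assms by (simp add: cyclic_graph_def)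
  show "finite (parcs (cyclic_graph G))"
    by (rule finite_subset[of _ "carrier G \<times> carrier G"])
      (use assms in \<open>auto simp: cyclic_graph_def\<close>)
  show "symmetric (with_proj (cyclic_graph G))"
    by (auto simp: symmetric_def cyclic_graph_def arcs_ends_def arc_to_ends_def sym_def insert_commute)
qed (auto simp: cyclic_graph_def)

definition dominating_vertex :: "'a pair_pre_digraph \<Rightarrow> 'a \<Rightarrow> bool" where
  "dominating_vertex \<Gamma> z \<longleftrightarrow>
    z \<in> pverts \<Gamma> \<and> (\<forall>x \<in> pverts \<Gamma>. x \<noteq> z \<longrightarrow> z \<rightarrow>\<^bsub>with_proj \<Gamma>\<^esub> x)"

definition dominatable :: "'a pair_pre_digraph \<Rightarrow> bool" where
  "dominatable \<Gamma> \<longleftrightarrow> (\<exists>z. dominating_vertex \<Gamma> z)"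

definition commutator_subgroup :: "('a, 'b) monoid_scheme \<Rightarrow> 'a set \<Rightarrow> 'a set \<Rightarrow> 'a set" where
  "commutator_subgroup G H K =
    generate G (\<Union>h \<in> H. \<Union>k \<in> K. {h \<otimes>\<^bsub>G\<^esub> k \<otimes>\<^bsub>G\<^esub> inv\<^bsub>G\<^esub> h \<otimes>\<^bsub>G\<^esub> inv\<^bsub>G\<^esub> k})"

lemma commutator_subgroup_self: "commutator_subgroup G H H = derived G H"
  by (simp add: commutator_subgroup_def derived_def)

text \<open>The index is shifted: \<open>lower_central_series G n\<close> is the term usually written
  \<open>\<gamma>\<close> with index \<open>n + 1\<close>.\<close>

primrec lower_central_series :: "('a, 'b) monoid_scheme \<Rightarrow> nat \<Rightarrow> 'a set" where
  "lower_central_series G 0 = carrier G"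
| "lower_central_series G (Suc n) = commutator_subgroup G (lower_central_series G n) (carrier G)"

definition nilpotent_group :: "('a, 'b) monoid_scheme \<Rightarrow> bool" where
  "nilpotent_group G \<longleftrightarrow> group G \<and> (\<exists>n. lower_central_series G n = {\<one>\<^bsub>G\<^esub>})"

definition sylow_subgroup :: "nat \<Rightarrow> 'a set \<Rightarrow> ('a, 'b) monoid_scheme \<Rightarrow> bool" where
  "sylow_subgroup p P G \<longleftrightarrow>
    prime p \<and> subgroup P G \<and> card P = p ^ multiplicity p (order G)"

text \<open>The group of order \<open>2 ^ n\<close> (\<open>n \<ge> 3\<close>) with generators \<open>x\<close>, \<open>y\<close> and defining relations
  \<open>x ^ (2 ^ (n - 1)) = 1\<close>, \<open>y ^ 2 = x ^ (2 ^ (n - 2))\<close>, \<open>y\<inverse> x y = x\<inverse>\<close>.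
  The relations bound the order of the presented group by \<open>2 ^ n\<close>, so prescribing
  the order excludes its proper quotients.\<close>

definition generalized_quaternion_group :: "('a, 'b) monoid_scheme \<Rightarrow> bool" where
  "generalized_quaternion_group G \<longleftrightarrow>
    group G \<and>
    (\<exists>n \<ge> 3. order G = 2 ^ n \<and>
      (\<exists>x \<in> carrier G. \<exists>y \<in> carrier G.
        generate G {x, y} = carrier G \<and>
        x [^]\<^bsub>G\<^esub> (2 ^ (n - 1) :: nat) = \<one>\<^bsub>G\<^esub> \<and>
        y [^]\<^bsub>G\<^esub> (2 :: nat) = x [^]\<^bsub>G\<^esub> (2 ^ (n - 2) :: nat) \<and>
        inv\<^bsub>G\<^esub> y \<otimes>\<^bsub>G\<^esub> x \<otimes>\<^bsub>G\<^esub> y = inv\<^bsub>G\<^esub> x))"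

end

theory Submission
  imports Defs "HOL-Number_Theory.Residues" "HOL-Algebra.Multiplicative_Group" "HOL-Algebra.Zassenhaus"
begin

text \<open>
  Both sides of the equivalence say that, for some prime \<open>p\<close>, the group has exactly one subgroup of
  order \<open>p\<close>. A generator \<open>z\<close> of such a subgroup is called a \<open>torsion_generator\<close> below.

  A dominating vertex has a power \<open>z\<close> of prime order \<open>p\<close>, and every \<open>t\<close> with \<open>t ^ p = 1\<close> lies with
  \<open>z\<close> in a common cyclic group. As a cyclic group has at most one subgroup of order \<open>p\<close>, it
  follows that \<open>t\<close> is a power of \<open>z\<close>. Conversely, let \<open>z\<close> generate the only subgroup of order \<open>p\<close> of a
  nilpotent group. That subgroup is normal of prime order, hence central. If \<open>p\<close> divides the order
  of \<open>x\<close>, then \<open>z\<close> is a power of \<open>x\<close>; otherwise \<open>x\<close> and \<open>z\<close> commute and have coprime orders, and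
  their product generates both. So \<open>z\<close> dominates.

  In a nilpotent group a Sylow \<open>p\<close>-subgroup \<open>P\<close> contains all \<open>p\<close>-elements
  (\<open>sylow_contains_p_elements\<close>), so \<open>G\<close> and \<open>P\<close> have the same subgroups of order \<open>p\<close>. What
  remains is the classical classification of the \<open>p\<close>-groups with exactly one subgroup of order \<open>p\<close>.
  Let \<open>A = \<langle>a\<rangle>\<close> be a normal cyclic subgroup of largest order \<open>p ^ n\<close>. It is its own centralizer
  (\<open>maximal_cyclic_normal_self_centralizing\<close>). Let \<open>b \<notin> A\<close> with \<open>b ^ p = a ^ s \<in> A\<close> and
  \<open>b a b\<inverse> = a ^ k\<close>. Then \<open>(a ^ j b) ^ p = a ^ (j S + s)\<close> for \<open>S = 1 + k + \<dots> + k ^ (p - 1)\<close>, and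
  this is never 1, because \<open>A\<close> contains all elements of order \<open>p\<close>. As \<open>b\<close> does not centralize \<open>a\<close>,
  the insolvability of \<open>j S + s \<equiv> 0\<close> modulo \<open>p ^ n\<close> forces \<open>p = 2\<close>, \<open>k \<equiv> -1\<close> and \<open>s \<equiv> 2 ^ (n - 1)\<close>
  (\<open>unsolvable_norm_equation\<close>). Hence \<open>b\<close> inverts \<open>a\<close>. Since \<open>-1\<close> is not a square modulo 4 and two
  elements that invert \<open>a\<close> differ by an element of \<open>A\<close>, the index of \<open>A\<close> is at most 2, and the
  group is either \<open>A\<close> or generalized quaternion.
\<close>

section \<open>A congruence modulo prime powers\<close>

lemma power_minus_first_order_dvd:
  fixes k :: int
  shows "(k - 1)\<^sup>2 dvd k ^ i - 1 - int i * (k - 1)"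
proof (induction i)
  case (Suc i)
  have "k ^ Suc i - 1 - int (Suc i) * (k - 1)
      = k * (k ^ i - 1 - int i * (k - 1)) + int i * (k - 1)\<^sup>2"
    by (simp add: algebra_simps power2_eq_square)
  then show ?case
    using Suc.IH by simp
qed simp

text \<open>By the first-order expansion of \<open>k ^ i\<close> at \<open>k = 1\<close>, the sum is congruent modulo \<open>p\<^sup>2\<close> to
  \<open>p + (k - 1) p (p - 1) / 2\<close>, whose second term vanishes for odd \<open>p\<close>. For \<open>p = 2\<close> the sum is
  \<open>1 + k\<close>, and the same conclusion needs \<open>k \<equiv> 1\<close> modulo 4: this is where the generalized quaternion
  groups come from.\<close>

lemma geometric_sum_prime_valuation_one:
  fixes p :: nat and k :: int
  assumes p: "prime p" and dvd: "int p dvd k - 1" and odd_or: "p \<noteq> 2 \<or> 4 dvd k - 1"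
  obtains w where "(\<Sum>i<p. k ^ i) = int p * w" and "\<not> int p dvd w"
proof -
  have "(int p)\<^sup>2 dvd (\<Sum>i<p. k ^ i) - int p"
  proof (cases "p = 2")
    case True
    then show ?thesis
      using odd_or by (simp add: numeral_2_eq_2)
  next
    case False
    then have "odd p"
      using p by (metis prime_odd_nat prime_ge_2_nat le_neq_implies_less)
    then obtain h where h: "p = 2 * h + 1"
      by (rule oddE)
    have gauss: "(\<Sum>i<p. int i) = int p * int h"
    proof -
      have "2 * (\<Sum>i<m. int i) = int m * (int m - 1)" for m
        by (induction m) (auto simp: algebra_simps)
      from this[of p] show ?thesis
        using h by simp
    qed
    have "(\<Sum>i<p. k ^ i) - int p
        = (\<Sum>i<p. k ^ i - 1 - int i * (k - 1)) + (\<Sum>i<p. int i) * (k - 1)"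
      by (simp add: sum_subtractf sum_distrib_right)
    also have "(\<Sum>i<p. int i) * (k - 1) = int h * (int p * (k - 1))"
      by (simp add: gauss)
    finally have eq: "(\<Sum>i<p. k ^ i) - int p
        = (\<Sum>i<p. k ^ i - 1 - int i * (k - 1)) + int h * (int p * (k - 1))" .
    have "(int p)\<^sup>2 dvd (k - 1)\<^sup>2"
      using dvd by simp
    then have "(int p)\<^sup>2 dvd k ^ i - 1 - int i * (k - 1)" for i
      using power_minus_first_order_dvd dvd_trans by blast
    moreover have "(int p)\<^sup>2 dvd int p * (k - 1)"
      using dvd by (simp add: power2_eq_square)
    ultimately show ?thesis
      unfolding eq by (intro dvd_add dvd_sum dvd_mult[of _ "int p * (k - 1)"]) auto
  qed
  then obtain v where v: "(\<Sum>i<p. k ^ i) - int p = (int p)\<^sup>2 * v"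
    by (auto elim: dvdE)
  show ?thesis
  proof
    show "(\<Sum>i<p. k ^ i) = int p * (1 + int p * v)"
      using v by (simp add: algebra_simps power2_eq_square)
    show "\<not> int p dvd 1 + int p * v"
      using p by (simp add: dvd_add_left_iff prime_nat_iff)
  qed
qed

lemma half_power_of_two_cong:
  fixes x :: int
  assumes "2 ^ n dvd 2 * x" and "\<not> 2 ^ n dvd x" and "n \<ge> 1"
  shows "2 ^ n dvd x - 2 ^ (n - 1)"
proof -
  have n: "(2::int) ^ n = 2 * 2 ^ (n - 1)"
    using assms(3) by (metis Suc_diff_1 Suc_le_eq One_nat_def power_Suc)
  with assms(1) obtain u where u: "x = 2 ^ (n - 1) * u"
    by (auto elim!: dvdE)
  then have "odd u"
    using assms(2) n by (auto elim!: evenE)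
  then obtain v where "u = 2 * v + 1" by (rule oddE)
  then have "x - 2 ^ (n - 1) = 2 ^ n * v"
    by (simp add: n u algebra_simps)
  then show ?thesis by simp
qed

text \<open>In the application \<open>b\<close> acts on a cyclic group of order \<open>p ^ n\<close> with generator \<open>a\<close> by the \<open>k\<close>-th power
  map, and \<open>b ^ p = a ^ s\<close>. The assumptions on \<open>k\<close> and \<open>s\<close> say, in order, that \<open>b ^ p\<close> acts trivially, that \<open>b\<close>
  commutes with \<open>b ^ p\<close>, that \<open>b\<close> does not act trivially, and that no element \<open>a ^ j b\<close> has \<open>p\<close>-th
  power 1. The second and third make \<open>s\<close> divisible by \<open>p\<close>, so that \<open>j S + s \<equiv> 0\<close> can be solved whenever
  \<open>S\<close> is \<open>p\<close> times a unit. This leaves \<open>p = 2\<close> and \<open>k \<equiv> 3\<close> modulo 4, where \<open>j = 0\<close> and \<open>j = 1\<close> both fail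
  to be solutions only for the stated residues of \<open>k\<close> and \<open>s\<close>.\<close>

lemma unsolvable_norm_equation:
  fixes p n :: nat and k s :: int
  assumes p: "prime p"
    and k_pow: "int p ^ n dvd k ^ p - 1"
    and s_fixed: "int p ^ n dvd s * (k - 1)"
    and k_ne_1: "\<not> int p ^ n dvd k - 1"
    and no_sol: "\<And>j. \<not> int p ^ n dvd j * (\<Sum>i<p. k ^ i) + s"
  shows "p = 2" and "int p ^ n dvd k + 1" and "int p ^ n dvd s - 2 ^ (n - 1)" and "n \<ge> 2"
proof -
  have prime: "prime (int p)"
    using p by simp
  have n: "n \<ge> 1"
    using k_ne_1 by (cases n) auto
  have p_dvd_s: "int p dvd s"
  proof (rule ccontr)
    assume "\<not> int p dvd s"
    then have "coprime (int p ^ n) s"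
      using prime by (simp add: prime_imp_coprime)
    then show False
      using s_fixed k_ne_1 by (simp add: coprime_dvd_mult_right_iff)
  qed
  have p_dvd_k1: "int p dvd k - 1"
  proof -
    have pk: "int p dvd k ^ p - 1"
      using k_pow n by (metis dvd_power dvd_trans le_eq_less_or_eq less_le_trans zero_less_one)
    have "\<not> int p dvd k"
    proof
      assume "int p dvd k"
      then have "int p dvd k ^ p"
        using p by (simp add: dvd_power_le prime_gt_0_nat dvd_trans[OF _ dvd_power])
      with pk have "int p dvd 1"
        by (metis dvd_diff_right_iff)
      then show False
        using prime not_prime_unit by blast
    qed
    moreover define r where "r = nat (k mod int p)"
    ultimately have "int r = k mod int p" and "\<not> p dvd r"
      using p by (auto simp: prime_gt_0_nat dvd_mod_iff simp flip: int_dvd_int_iff)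
    then have "[k ^ (p - 1) = int r ^ (p - 1)] (mod int p)"
      by (intro cong_pow) (simp add: cong_def)
    also have "[int r ^ (p - 1) = 1] (mod int p)"
      using fermat_theorem[OF p \<open>\<not> p dvd r\<close>] by (simp flip: cong_int_iff)
    finally have "[k ^ (p - 1) = 1] (mod int p)" .
    then have "[k * k ^ (p - 1) = k * 1] (mod int p)"
      by (rule cong_scalar_left)
    then have "[k ^ p = k] (mod int p)"
      using p by (metis mult_1_right power_Suc Suc_diff_1 prime_gt_0_nat)
    then have "int p dvd k ^ p - k"
      by (simp add: cong_iff_dvd_diff)
    with pk have "int p dvd (k ^ p - 1) - (k ^ p - k)"
      by (rule dvd_diff)
    then show ?thesis by simp
  qed
  \<comment> \<open>Otherwise \<open>S = p w\<close> with \<open>w\<close> a unit modulo \<open>p\<close>, and \<open>j = - (s / p) / w\<close> solves the equation.\<close>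
  have special: "p = 2 \<and> \<not> 4 dvd k - 1"
  proof (rule ccontr)
    assume "\<not> (p = 2 \<and> \<not> 4 dvd k - 1)"
    then have "p \<noteq> 2 \<or> 4 dvd k - 1" by blast
    then obtain w where S: "(\<Sum>i<p. k ^ i) = int p * w" and w: "\<not> int p dvd w"
      using geometric_sum_prime_valuation_one[OF p p_dvd_k1] by blast
    obtain r where r: "s = int p * r"
      using p_dvd_s by (elim dvdE)
    have "coprime w (int p ^ n)"
      using w prime by (simp add: prime_imp_coprime coprime_commute[of w])
    then obtain u where "[w * u = 1] (mod int p ^ n)"
      using cong_solve_coprime_int by blast
    then have u: "int p ^ n dvd w * u - 1"
      by (simp add: cong_iff_dvd_diff)
    have "(- r * u) * (\<Sum>i<p. k ^ i) + s = (w * u - 1) * (- r * int p)"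
      by (simp add: S r algebra_simps)
    then show False
      using no_sol[of "- r * u"] u by simp
  qed
  then show p2: "p = 2" by blast
  obtain u where u: "k - 1 = 2 * u"
    using p_dvd_k1 unfolding p2 by (metis dvdE of_nat_numeral)
  have "odd u"
    using special u by (auto elim!: evenE)
  then have cop: "coprime ((2::int) ^ n) u"
    by simp
  have "(2::int) ^ n dvd u * (2 * s)"
    using s_fixed u p2 by (simp add: algebra_simps)
  then have s2: "2 ^ n dvd 2 * s"
    using cop by (simp add: coprime_dvd_mult_right_iff)
  have sn: "\<not> 2 ^ n dvd s"
    using no_sol[of 0] p2 by simp
  from half_power_of_two_cong[OF s2 sn n]
  show s_half: "int p ^ n dvd s - 2 ^ (n - 1)" using p2 by simp
  have "k ^ p - 1 = u * (2 * (k + 1))"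
    using u p2 by (simp add: algebra_simps power2_eq_square)
  then have k2: "2 ^ n dvd 2 * (k + 1)"
    using k_pow cop p2 by (simp add: coprime_dvd_mult_right_iff)
  \<comment> \<open>Otherwise both \<open>S = k + 1\<close> and \<open>s\<close> are \<open>2 ^ (n - 1)\<close> modulo \<open>2 ^ n\<close>, so \<open>j = 1\<close> is a solution.\<close>
  show "int p ^ n dvd k + 1"
  proof (rule ccontr)
    assume "\<not> int p ^ n dvd k + 1"
    then have "2 ^ n dvd (k + 1) - 2 ^ (n - 1)"
      using half_power_of_two_cong[OF k2 _ n] p2 by simp
    moreover have "2 ^ n dvd s - 2 ^ (n - 1)"
      using s_half p2 by simp
    ultimately have "2 ^ n dvd ((k + 1) - 2 ^ (n - 1)) + (s - 2 ^ (n - 1)) + 2 * 2 ^ (n - 1)"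
      using n by (intro dvd_add) (simp_all flip: power_Suc)
    then have "2 ^ n dvd 1 * (\<Sum>i<p. k ^ i) + s"
      using p2 by (simp add: numeral_2_eq_2 algebra_simps)
    then show False
      using no_sol[of 1] p2 by simp
  qed
  show "n \<ge> 2"
  proof (rule ccontr)
    assume "\<not> n \<ge> 2"
    with n have "n = 1" by simp
    then show False
      using k_ne_1 u p2 by simp
  qed
qed

lemma not_four_dvd_square_plus_one:
  fixes l :: int
  shows "\<not> 4 dvd l\<^sup>2 + 1"
proof (cases "even l")
  case True
  then have "4 dvd l\<^sup>2" by (auto elim!: evenE simp: power2_eq_square)
  then show ?thesis by (simp add: dvd_add_right_iff)
next
  case False
  then obtain e where "l = 2 * e + 1" by (rule oddE)
  then have "l\<^sup>2 + 1 = 4 * (e * e + e) + 2"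
    by (simp add: power2_eq_square algebra_simps)
  then have "(l\<^sup>2 + 1) mod 4 = 2"
    by (simp only: mod_mult_self4) simp
  then show ?thesis by (simp add: dvd_eq_mod_eq_0)
qed

section \<open>Cyclic subgroups and elements of prime order\<close>

text \<open>For a prime \<open>p\<close>: the element \<open>z\<close> generates the unique subgroup of order \<open>p\<close>. Naming a generator
  avoids counting subgroups and makes the notion easy to transport between a group and a subgroup.\<close>

definition torsion_generator :: "('a, 'b) monoid_scheme \<Rightarrow> nat \<Rightarrow> 'a \<Rightarrow> bool" where
  "torsion_generator G p z \<longleftrightarrow>
    z \<in> carrier G \<and> z \<noteq> \<one>\<^bsub>G\<^esub> \<and> z [^]\<^bsub>G\<^esub> p = \<one>\<^bsub>G\<^esub> \<and>
    (\<forall>t \<in> carrier G. t [^]\<^bsub>G\<^esub> p = \<one>\<^bsub>G\<^esub> \<longrightarrow> t \<in> generate G {z})"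

context group
begin

lemma cancel_inv:
  assumes "g \<in> carrier G" "h \<in> carrier G"
  shows "g \<otimes> (inv g \<otimes> h) = h" and "inv g \<otimes> (g \<otimes> h) = h"
  using assms by (simp_all flip: m_assoc)

lemma mem_generate_singleton_iff:
  assumes "a \<in> carrier G"
  shows "x \<in> generate G {a} \<longleftrightarrow> (\<exists>i::int. x = a [^] i)"
  using assms by (auto simp: generate_pow)

lemma generate_singleton_subset:
  assumes "a \<in> carrier G" and "x \<in> generate G {a}"
  shows "generate G {x} \<subseteq> generate G {a}"
  using assms by (intro generate_subgroup_incl generate_is_subgroup) auto

lemma coprime_power_generates:
  fixes s :: int
  assumes a: "a \<in> carrier G" and s: "coprime s (int (ord a))"
  shows "a \<in> generate G {a [^] s}"
proof -
  obtain u where "[s * u = 1] (mod int (ord a))"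
    using cong_solve_coprime_int[OF s] by blast
  then have "a [^] (s * u) = a [^] (1::int)"
    using a by (simp add: int_pow_eq cong_iff_dvd_diff dvd_diff_commute del: int_pow_1)
  then have "a = (a [^] s) [^] u"
    using a by (simp add: int_pow_pow)
  then show ?thesis
    using a mem_generate_singleton_iff[of "a [^] s"] by auto
qed

text \<open>A cyclic group has at most one subgroup of order \<open>p\<close>. With \<open>N\<close> the order of \<open>c\<close> (0 if infinite),
  an exponent of \<open>c\<close> killed by \<open>p\<close> is a multiple of \<open>M = N / p\<close>, and a nontrivial one is \<open>M\<close> times a
  unit modulo \<open>p\<close>.\<close>

lemma cyclic_torsion_unique:
  fixes p :: nat
  assumes p: "prime p" and c: "c \<in> carrier G"
    and u: "u \<in> generate G {c}" "u \<noteq> \<one>" "u [^] p = \<one>"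
    and t: "t \<in> generate G {c}" "t [^] p = \<one>"
  shows "t \<in> generate G {u}"
proof -
  obtain i j :: int where i: "u = c [^] i" and j: "t = c [^] j"
    using u t c by (auto simp: mem_generate_singleton_iff)
  let ?N = "int (ord c)"
  have Ni: "?N dvd i * int p"
    using u(3) c by (simp add: i int_pow_pow int_pow_eq_id flip: int_pow_int)
  have Nj: "?N dvd j * int p"
    using t(2) c by (simp add: j int_pow_pow int_pow_eq_id flip: int_pow_int)
  have not: "\<not> ?N dvd i"
    using u(2) c by (simp add: i int_pow_eq_id)
  have "int p dvd ?N"
  proof (rule ccontr)
    assume "\<not> int p dvd ?N"
    then have "coprime ?N (int p)"
      using p by (metis prime_imp_coprime coprime_commute prime_nat_int_transfer)
    with Ni not show False
      by (simp add: coprime_dvd_mult_left_iff)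
  qed
  then obtain M where M: "?N = int p * M" by (elim dvdE)
  have p0: "int p \<noteq> 0" using p by auto
  have "M dvd i" "M dvd j"
    using Ni Nj p0 M by (auto simp: mult.commute[of _ "int p"])
  then obtain i' j' where i': "i = M * i'" and j': "j = M * j'"
    by (elim dvdE)
  have "\<not> int p dvd i'"
    using not mult_dvd_mono[of "int p" i' M M] M i' by (metis dvd_refl mult.commute)
  then have "coprime i' (int p)"
    using p by (metis prime_imp_coprime coprime_commute prime_nat_int_transfer)
  then obtain w where "[i' * w = 1] (mod int p)"
    using cong_solve_coprime_int by blast
  then have "int p dvd 1 - i' * w"
    by (simp add: cong_iff_dvd_diff dvd_diff_commute)
  then have "?N dvd (1 - i' * w) * (M * j')"
    unfolding M by (intro mult_dvd_mono) auto
  then have "?N dvd j - i * (w * j')"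
    by (simp add: i' j' algebra_simps)
  then have "?N dvd i * (w * j') - j"
    by (simp add: dvd_diff_commute)
  then have "t = u [^] (w * j')"
    using c by (simp add: i j int_pow_pow int_pow_eq dvd_diff_commute)
  then show ?thesis
    using c i mem_generate_singleton_iff[of u] by auto
qed

lemma ord_torsion_generator:
  assumes "prime p" and "torsion_generator G p z"
  shows "ord z = p"
  using assms by (metis torsion_generator_def pow_eq_id prime_nat_iff ord_eq_1)

text \<open>A suitable power of \<open>x\<close> has order \<open>p\<close>, hence generates the same subgroup as \<open>z\<close>.\<close>

lemma torsion_generator_mem:
  assumes p: "prime p" and z: "torsion_generator G p z"
    and x: "x \<in> carrier G" and dvd: "p dvd ord x" and fin: "ord x \<noteq> 0"
  shows "z \<in> generate G {x}"
proof -
  define u where "u = x [^] (ord x div p)"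
  have u: "u \<in> carrier G" "u [^] p = \<one>"
    using x dvd by (auto simp: u_def nat_pow_pow)
  have "\<not> ord x dvd ord x div p"
    using fin dvd p by (auto elim!: dvdE simp: prime_gt_0_nat dest!: dvd_imp_le)
  then have "u \<noteq> \<one>"
    using x by (simp add: u_def pow_eq_id)
  have zc: "z \<in> carrier G" and zp: "z [^] p = \<one>" and "u \<in> generate G {z}"
    using z u by (auto simp: torsion_generator_def)
  then have "z \<in> generate G {u}"
    using cyclic_torsion_unique[OF p zc _ \<open>u \<noteq> \<one>\<close> u(2) _ zp] by (simp add: generate.incl)
  moreover have "u \<in> generate G {x}"
    using x by (auto simp: u_def mem_generate_singleton_iff simp flip: int_pow_int)
  ultimately show ?thesis
    using generate_singleton_subset x by blast
qed

section \<open>Conjugation acting on a cyclic subgroup\<close>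

lemma conj_hom:
  assumes "g \<in> carrier G"
  shows "(\<lambda>x. g \<otimes> x \<otimes> inv g) \<in> hom G G"
  using assms by (auto intro!: homI simp: m_assoc inv_solve_left)

lemma conj_int_pow:
  assumes "g \<in> carrier G" "x \<in> carrier G"
  shows "g \<otimes> x [^] (i::int) \<otimes> inv g = (g \<otimes> x \<otimes> inv g) [^] i"
proof -
  interpret conj: group_hom G G "\<lambda>x. g \<otimes> x \<otimes> inv g"
    using conj_hom[OF assms(1)] by unfold_locales
  show ?thesis using conj.hom_int_pow[OF assms(2)] .
qed

lemma conj_pow:
  assumes "g \<in> carrier G" "x \<in> carrier G"
  shows "g \<otimes> x [^] (i::nat) \<otimes> inv g = (g \<otimes> x \<otimes> inv g) [^] i"
  using conj_int_pow[OF assms, of "int i"] by (simp only: int_pow_int)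

lemma conj_eq_iff:
  assumes "g \<in> carrier G" "x \<in> carrier G" "y \<in> carrier G"
  shows "g \<otimes> x \<otimes> inv g = y \<longleftrightarrow> g \<otimes> x = y \<otimes> g"
  using assms by (metis inv_closed m_assoc m_closed r_inv r_one l_inv)

text \<open>The relation \<open>b a = a ^ k b\<close> says that conjugation by \<open>b\<close> is the \<open>k\<close>-th power map on \<open>\<langle>a\<rangle>\<close>; this
  form is kept because it rewrites products directly into normal form \<open>a ^ i b ^ m\<close>.\<close>

lemma twisted_commute_pow:
  fixes k j :: int and m :: nat
  assumes a: "a \<in> carrier G" and b: "b \<in> carrier G" and ba: "b \<otimes> a = a [^] k \<otimes> b"
  shows "b [^] m \<otimes> a [^] j = a [^] (k ^ m * j) \<otimes> b [^] m"
proof (induction m arbitrary: j)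
  case (Suc m)
  have one: "b \<otimes> a [^] i = a [^] (k * i) \<otimes> b" for i :: int
  proof -
    have "b \<otimes> a \<otimes> inv b = a [^] k"
      using a b conj_eq_iff[of b a "a [^] k"] ba by blast
    then have "b \<otimes> a [^] i \<otimes> inv b = a [^] (k * i)"
      using a b by (simp add: conj_int_pow int_pow_pow)
    then show ?thesis
      using a b conj_eq_iff[of b "a [^] i" "a [^] (k * i)"] by simp
  qed
  have "b [^] Suc m \<otimes> a [^] j = b [^] m \<otimes> (b \<otimes> a [^] j)"
    using a b by (simp add: m_assoc)
  also have "\<dots> = (b [^] m \<otimes> a [^] (k * j)) \<otimes> b"
    using a b by (simp add: one m_assoc)
  also have "\<dots> = a [^] (k ^ Suc m * j) \<otimes> b [^] Suc m"
    using a b by (simp add: Suc.IH m_assoc mult.assoc mult.left_commute)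
  finally show ?case .
qed (use a in simp)

lemma twisted_commute:
  fixes k j :: int
  assumes "a \<in> carrier G" and "b \<in> carrier G" and "b \<otimes> a = a [^] k \<otimes> b"
  shows "b \<otimes> a [^] j = a [^] (k * j) \<otimes> b"
  using twisted_commute_pow[OF assms, of 1] assms by simp

lemma commute_int_pow:
  assumes "a \<in> carrier G" "b \<in> carrier G" "b \<otimes> a = a \<otimes> b"
  shows "b \<otimes> a [^] (i::int) = a [^] i \<otimes> b"
  using twisted_commute[of a b 1 i] assms by simp

text \<open>Collecting the powers of \<open>a\<close> on the left produces the exponent \<open>j\<close> times the norm
  \<open>1 + k + \<dots> + k ^ (m - 1)\<close> of the action.\<close>

lemma twisted_pow:
  fixes k j :: int and m :: nat
  assumes a: "a \<in> carrier G" and b: "b \<in> carrier G" and ba: "b \<otimes> a = a [^] k \<otimes> b"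
  shows "(a [^] j \<otimes> b) [^] m = a [^] (j * (\<Sum>i<m. k ^ i)) \<otimes> b [^] m"
proof (induction m)
  case (Suc m)
  have "(a [^] j \<otimes> b) [^] Suc m = a [^] (j * (\<Sum>i<m. k ^ i)) \<otimes> (b [^] m \<otimes> a [^] j) \<otimes> b"
    using a b by (simp add: Suc.IH m_assoc)
  also have "\<dots> = a [^] (j * (\<Sum>i<m. k ^ i)) \<otimes> a [^] (k ^ m * j) \<otimes> (b [^] m \<otimes> b)"
    using a b by (simp add: twisted_commute_pow[OF a b ba] m_assoc)
  also have "\<dots> = a [^] (j * (\<Sum>i<Suc m. k ^ i)) \<otimes> b [^] Suc m"
    using a b by (simp add: distrib_left mult.commute flip: int_pow_mult)
  finally show ?case .
qed (use a in simp)

lemma generate_singleton_normal: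
  assumes a: "a \<in> carrier G" and conj: "\<And>g. g \<in> carrier G \<Longrightarrow> g \<otimes> a \<otimes> inv g \<in> generate G {a}"
  shows "generate G {a} \<lhd> G"
proof -
  have sub: "subgroup (generate G {a}) G"
    using a by (simp add: generate_is_subgroup)
  show ?thesis
    unfolding normal_inv_iff
  proof (intro conjI sub ballI)
    fix g h assume g: "g \<in> carrier G" and "h \<in> generate G {a}"
    then obtain i :: int where "h = a [^] i"
      using a mem_generate_singleton_iff by blast
    then have "g \<otimes> h \<otimes> inv g = (g \<otimes> a \<otimes> inv g) [^] i"
      using a g by (simp add: conj_int_pow)
    also have "\<dots> \<in> generate G {a}"
      using subgroup_int_pow_closed[OF sub conj[OF g]] .
    finally show "g \<otimes> h \<otimes> inv g \<in> generate G {a}" .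
  qed
qed

text \<open>Conjugates of \<open>z\<close> have \<open>p\<close>-th power 1.\<close>

lemma torsion_generator_normal:
  assumes z: "torsion_generator G p z"
  shows "generate G {z} \<lhd> G"
proof (rule generate_singleton_normal)
  show "z \<in> carrier G"
    using z by (simp add: torsion_generator_def)
  fix g assume "g \<in> carrier G"
  then have "(g \<otimes> z \<otimes> inv g) [^] p = \<one>"
    using z by (simp add: torsion_generator_def flip: conj_pow)
  then show "g \<otimes> z \<otimes> inv g \<in> generate G {z}"
    using z \<open>g \<in> carrier G\<close> by (auto simp: torsion_generator_def)
qed

text \<open>The structural core of the classification: outside a cyclic subgroup that contains all elements
  of order \<open>p\<close>, an element that normalizes but does not centralize it, and whose \<open>p\<close>-th power falls
  into it, can only occur as in a generalized quaternion group. Every coset representative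
  \<open>a ^ j b\<close> has nontrivial \<open>p\<close>-th power, which turns the question into a congruence for the
  exponents.\<close>

lemma involutive_inversion_outside_cyclic:
  assumes p: "prime p" and a: "a \<in> carrier G" and b: "b \<in> carrier G"
    and ord_a: "ord a = p ^ n"
    and conj: "b \<otimes> a \<otimes> inv b \<in> generate G {a}"
    and b_notin: "b \<notin> generate G {a}" and bp: "b [^] p \<in> generate G {a}"
    and ncomm: "b \<otimes> a \<noteq> a \<otimes> b"
    and torsion: "\<And>t. t \<in> carrier G \<Longrightarrow> t [^] p = \<one> \<Longrightarrow> t \<in> generate G {a}"
  shows "p = 2" and "b \<otimes> a = inv a \<otimes> b" and "b [^] (2::nat) = a [^] (2 ^ (n - 1) :: nat)"
    and "n \<ge> 2"
proof -
  obtain k :: int where "b \<otimes> a \<otimes> inv b = a [^] k"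
    using conj a mem_generate_singleton_iff by blast
  then have ba: "b \<otimes> a = a [^] k \<otimes> b"
    using a b by (simp add: conj_eq_iff)
  obtain s :: int where s: "b [^] p = a [^] s"
    using bp a mem_generate_singleton_iff by blast
  have ord: "int (ord a) = int p ^ n"
    by (simp add: ord_a)
  have 1: "int p ^ n dvd k ^ p - 1"
  proof -
    have "a [^] (k ^ p) \<otimes> a [^] s = a [^] s \<otimes> a [^] (1::int)"
      using twisted_commute_pow[OF a b ba, of p 1] by (simp add: s)
    then have "a [^] (k ^ p + s) = a [^] (s + 1)"
      using a by (simp only: int_pow_mult)
    then show ?thesis
      using a by (simp add: int_pow_eq ord dvd_diff_commute)
  qed
  have 2: "int p ^ n dvd s * (k - 1)"
  proof -
    have "a [^] (k * s) \<otimes> b = a [^] s \<otimes> b"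
      using twisted_commute[OF a b ba, of s] b by (metis s nat_pow_Suc nat_pow_Suc2)
    then have "a [^] (k * s) = a [^] s"
      using a b by simp
    then show ?thesis
      using a by (simp add: int_pow_eq ord dvd_diff_commute algebra_simps)
  qed
  have 3: "\<not> int p ^ n dvd k - 1"
  proof
    assume "int p ^ n dvd k - 1"
    then have "a [^] k = a [^] (1::int)"
      using a by (simp add: int_pow_eq ord dvd_diff_commute del: int_pow_1)
    then show False
      using ncomm ba a by simp
  qed
  have 4: "\<not> int p ^ n dvd j * (\<Sum>i<p. k ^ i) + s" for j
  proof
    assume "int p ^ n dvd j * (\<Sum>i<p. k ^ i) + s"
    then have "(a [^] j \<otimes> b) [^] p = \<one>"
      using a by (simp add: twisted_pow[OF a b ba] s int_pow_mult[symmetric] int_pow_eq_id ord)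
    then have "a [^] j \<otimes> b \<in> generate G {a}"
      using a b by (intro torsion) auto
    then obtain i :: int where "a [^] j \<otimes> b = a [^] i"
      using a mem_generate_singleton_iff by blast
    then have "b = a [^] (i - j)"
      using a b by (metis int_pow_closed int_pow_diff int_pow_mult int_pow_neg inv_solve_left
          add.commute diff_conv_add_uminus uminus_add_conv_diff)
    then show False
      using b_notin a mem_generate_singleton_iff by blast
  qed
  note * = unsolvable_norm_equation[OF p 1 2 3 4]
  show p2: "p = 2" and "n \<ge> 2"
    by (fact *)+
  have "a [^] k = a [^] (- 1 :: int)"
    using *(2) a by (metis int_pow_eq ord dvd_diff_commute diff_minus_eq_add)
  then have "a [^] k = inv a"
    using a by (simp only: int_pow_neg int_pow_1)
  then show "b \<otimes> a = inv a \<otimes> b"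
    using ba by simp
  have "a [^] s = a [^] (2 ^ (n - 1) :: nat)"
    using *(3) a by (simp add: int_pow_eq ord dvd_diff_commute flip: int_pow_int)
  then show "b [^] (2::nat) = a [^] (2 ^ (n - 1) :: nat)"
    using s p2 by simp
qed

section \<open>Nilpotent groups\<close>

lemma commutator_subset_carrier:
  assumes "H \<subseteq> carrier G" "K \<subseteq> carrier G"
  shows "(\<Union>h \<in> H. \<Union>k \<in> K. {h \<otimes> k \<otimes> inv h \<otimes> inv k}) \<subseteq> carrier G"
  using assms by (auto simp: subset_iff)

lemma lower_central_series_subgroup: "subgroup (lower_central_series G n) G"
proof (induction n)
  case (Suc n)
  then show ?case
    unfolding lower_central_series.simps commutator_subgroup_def
    by (intro generate_is_subgroup commutator_subset_carrier) (auto dest: subgroup.subset)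
qed (simp add: subgroup_self)

lemma commutator_in_lower_central_series:
  assumes "c \<in> lower_central_series G n" and "g \<in> carrier G"
  shows "c \<otimes> g \<otimes> inv c \<otimes> inv g \<in> lower_central_series G (Suc n)"
  using assms by (auto simp: commutator_subgroup_def intro: generate.incl)

lemma lower_central_series_of_subgroup:
  assumes P: "subgroup P G"
  shows "lower_central_series (G\<lparr>carrier := P\<rparr>) n \<subseteq> lower_central_series G n"
proof (induction n)
  case 0
  then show ?case using P by (simp add: subgroup.subset)
next
  case (Suc n)
  interpret P: group "G\<lparr>carrier := P\<rparr>"
    using P by (rule subgroup_imp_group)
  let ?L = "lower_central_series (G\<lparr>carrier := P\<rparr>) n"
  have L: "?L \<subseteq> P"
    using subgroup.subset[OF P.lower_central_series_subgroup[of n]] by simp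
  let ?C = "\<Union>h \<in> ?L. \<Union>k \<in> P. {h \<otimes> k \<otimes> inv h \<otimes> inv k}"
  have "(\<Union>h \<in> ?L. \<Union>k \<in> P. {h \<otimes> k \<otimes> inv\<^bsub>G\<lparr>carrier := P\<rparr>\<^esub> h \<otimes> inv\<^bsub>G\<lparr>carrier := P\<rparr>\<^esub> k}) = ?C"
    using L P by (intro SUP_cong refl) (auto simp: m_inv_consistent)
  moreover have "?C \<subseteq> P"
    using L P by (auto intro!: subgroup.m_closed subgroup.m_inv_closed)
  ultimately have "lower_central_series (G\<lparr>carrier := P\<rparr>) (Suc n) = generate G ?C"
    using P by (simp add: commutator_subgroup_def generate_consistent)
  also have "\<dots> \<subseteq> lower_central_series G (Suc n)"
    unfolding lower_central_series.simps commutator_subgroup_def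
    using Suc.IH subgroup.subset[OF P] by (intro mono_generate) auto
  finally show ?case .
qed

lemma subgroup_nilpotent:
  assumes G: "nilpotent_group G" and P: "subgroup P G"
  shows "nilpotent_group (G\<lparr>carrier := P\<rparr>)"
proof -
  interpret P: group "G\<lparr>carrier := P\<rparr>"
    using P by (rule subgroup_imp_group)
  obtain n where "lower_central_series G n = {\<one>}"
    using G by (auto simp: nilpotent_group_def)
  then have "lower_central_series (G\<lparr>carrier := P\<rparr>) n = {\<one>}"
    using lower_central_series_of_subgroup[OF P, of n]
      subgroup.one_closed[OF P.lower_central_series_subgroup[of n]] by auto
  then show ?thesis
    using P.group_axioms by (auto simp: nilpotent_group_def)
qed

text \<open>A normal subgroup \<open>N\<close> that is not inside \<open>A\<close> has a part outside \<open>A\<close> that is central modulo \<open>A\<close>: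
  intersect \<open>N\<close> with the last term of the lower central series for which the intersection is not
  inside \<open>A\<close>. For \<open>A\<close> a normal subgroup of a nilpotent group this says that a nontrivial normal
  subgroup of \<open>G / A\<close> meets the centre nontrivially.\<close>

lemma nilpotent_central_layer:
  assumes nil: "nilpotent_group G" and N: "N \<lhd> G" and "\<one> \<in> A" and NA: "\<not> N \<subseteq> A"
  obtains M where "subgroup M G" and "M \<subseteq> N" and "\<not> M \<subseteq> A"
    and "\<And>c g. c \<in> M \<Longrightarrow> g \<in> carrier G \<Longrightarrow> c \<otimes> g \<otimes> inv c \<otimes> inv g \<in> A"
proof -
  have subN: "subgroup N G" and conjN: "\<And>g h. g \<in> carrier G \<Longrightarrow> h \<in> N \<Longrightarrow> g \<otimes> h \<otimes> inv g \<in> N"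
    using N by (auto simp: normal_inv_iff)
  let ?P = "\<lambda>k. N \<inter> lower_central_series G k \<subseteq> A"
  obtain n where "lower_central_series G n = {\<one>}"
    using nil by (auto simp: nilpotent_group_def)
  then have "?P n" using \<open>\<one> \<in> A\<close> by auto
  define k where "k = (LEAST k. ?P k)"
  have k: "?P k"
    using \<open>?P n\<close> unfolding k_def by (rule LeastI)
  have "k \<noteq> 0"
    using k NA subgroup.subset[OF subN] by (auto simp: Int_absorb2)
  then obtain j where j: "k = Suc j" by (cases k) auto
  then have notP: "\<not> ?P j"
    using not_less_Least[of j ?P] by (simp add: k_def)
  show ?thesis
  proof
    show "subgroup (N \<inter> lower_central_series G j) G"
      using subN lower_central_series_subgroup by (rule subgroups_Inter_pair)
    show "\<not> N \<inter> lower_central_series G j \<subseteq> A" by (fact notP)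
    fix c g assume c: "c \<in> N \<inter> lower_central_series G j" and g: "g \<in> carrier G"
    then have cG: "c \<in> carrier G"
      using subN subgroup.mem_carrier by fastforce
    have "g \<otimes> inv c \<otimes> inv g \<in> N"
      using c g subN conjN by (simp add: subgroup.m_inv_closed)
    then have "c \<otimes> (g \<otimes> inv c \<otimes> inv g) \<in> N"
      using c subN by (simp add: subgroup.m_closed)
    then have "c \<otimes> g \<otimes> inv c \<otimes> inv g \<in> N"
      using cG g by (simp add: m_assoc)
    then show "c \<otimes> g \<otimes> inv c \<otimes> inv g \<in> A"
      using c g k commutator_in_lower_central_series[of c j g] by (auto simp: j)
  qed auto
qed

text \<open>Some nontrivial element of \<open>\<langle>z\<rangle>\<close> is central by the previous lemma, and since \<open>\<langle>z\<rangle>\<close> has prime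
  order, it generates \<open>z\<close>.\<close>

lemma torsion_generator_central:
  assumes nil: "nilpotent_group G" and p: "prime p" and z: "torsion_generator G p z"
    and g: "g \<in> carrier G"
  shows "g \<otimes> z = z \<otimes> g"
proof -
  have zG: "z \<in> carrier G" and z1: "z \<noteq> \<one>" and zp: "z [^] p = \<one>"
    using z by (auto simp: torsion_generator_def)
  have "\<not> generate G {z} \<subseteq> {\<one>}"
    using z1 generate.incl[of z "{z}" G] by auto
  then obtain M where M: "subgroup M G" "M \<subseteq> generate G {z}" "\<not> M \<subseteq> {\<one>}"
    and comm: "\<And>c g. c \<in> M \<Longrightarrow> g \<in> carrier G \<Longrightarrow> c \<otimes> g \<otimes> inv c \<otimes> inv g \<in> {\<one>}"
    using nilpotent_central_layer[OF nil torsion_generator_normal[OF z], of "{\<one>}"] by blast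
  obtain c where c: "c \<in> M" "c \<noteq> \<one>" using M(3) by auto
  have cG: "c \<in> carrier G"
    using subgroup.mem_carrier[OF M(1) c(1)] .
  have "c \<otimes> g \<otimes> inv c \<otimes> inv g = \<one>"
    using comm c g by blast
  then have gc: "g \<otimes> c = c \<otimes> g"
    using cG g by (metis inv_closed inv_solve_right m_closed l_one)
  obtain i :: int where i: "c = z [^] i"
    using c M(2) zG mem_generate_singleton_iff by blast
  have "c [^] p = \<one>"
    using zG zp by (metis i int_pow_int int_pow_one int_pow_pow mult.commute)
  then have "z \<in> generate G {c}"
    using c M(2) cyclic_torsion_unique[OF p zG _ c(2) _ _ zp] by (auto intro: generate.incl)
  then obtain j :: int where "z = c [^] j"
    using cG mem_generate_singleton_iff by blast
  then show ?thesis
    using commute_int_pow[OF cG g gc] by simp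
qed

lemma normalizerI:
  assumes H: "subgroup H G" and g: "g \<in> carrier G"
    and conj: "\<And>h. h \<in> H \<Longrightarrow> g \<otimes> h \<otimes> inv g \<in> H"
    and conj_inv: "\<And>h. h \<in> H \<Longrightarrow> inv g \<otimes> h \<otimes> g \<in> H"
  shows "g \<in> normalizer G H"
proof -
  have HG: "H \<subseteq> carrier G" using H by (rule subgroup.subset)
  have "h \<in> g <# H #> inv g" if h: "h \<in> H" for h
  proof -
    have "h = g \<otimes> (inv g \<otimes> h \<otimes> g) \<otimes> inv g"
      using h HG g by (simp add: m_assoc subset_iff cancel_inv)
    then show ?thesis
      using conj_inv[OF h] by (auto simp: l_coset_def r_coset_def)
  qed
  moreover have "g <# H #> inv g \<subseteq> H"
    using conj by (auto simp: l_coset_def r_coset_def)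
  ultimately have "g <# H #> inv g = H" by blast
  then show ?thesis
    using g HG by (simp add: normalizer_def stabilizer_def)
qed

text \<open>The order of the image of \<open>x\<close> in the quotient divides both a power of \<open>p\<close> and the index.\<close>

lemma p_element_in_coprime_normal:
  fixes p r :: nat
  assumes H: "H \<lhd> G" and index: "coprime (card (rcosets H)) p"
    and x: "x \<in> carrier G" and xp: "x [^] (p ^ r) = \<one>"
  shows "x \<in> H"
proof -
  interpret H: normal H G by (fact H)
  interpret Q: group "G Mod H" by (rule H.factorgroup_is_group)
  let ?q = "card (rcosets H)"
  have "H #> x \<in> carrier (G Mod H)"
    using x by (simp add: FactGroup_def rcosetsI H.subset)
  then have "(H #> x) [^]\<^bsub>G Mod H\<^esub> ?q = \<one>\<^bsub>G Mod H\<^esub>"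
    using Q.pow_order_eq_1[of "H #> x"] by (simp add: order_def FactGroup_def)
  then have "H #> (x [^] ?q) = H"
    using x by (simp add: H.FactGroup_pow)
  then have q: "x [^] ?q \<in> H"
    using x by (metis coset_join1 nat_pow_closed H.subset H.subgroup_axioms)
  have "coprime (int ?q) (int (p ^ r))"
    using index by (simp flip: coprime_int_iff)
  then obtain u v where uv: "u * int ?q + v * int (p ^ r) = 1"
    using bezout_int[of "int ?q" "int (p ^ r)"] by (auto simp: coprime_iff_gcd_eq_1)
  have "x = x [^] (int ?q * u + int (p ^ r) * v)"
    using uv x by (simp add: mult.commute)
  also have "\<dots> = (x [^] ?q) [^] u \<otimes> (x [^] (p ^ r)) [^] v"
    using x by (simp add: int_pow_mult int_pow_pow flip: int_pow_int)
  also have "\<dots> = (x [^] ?q) [^] u"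
    using x by (simp add: xp)
  finally have "x = (x [^] ?q) [^] u" .
  then show ?thesis
    using subgroup_int_pow_closed[OF H.subgroup_axioms q, of u] by simp
qed

text \<open>Start from \<open>G\<close> and descend to \<open>P\<close>: if a subgroup \<open>H\<close> contains the next term of the lower central
  series, then its normalizer contains the current one. So \<open>x\<close> lies in the normalizer of
  \<open>H\<close> by induction, and then in \<open>H\<close> itself, because the index of \<open>H\<close> in its normalizer is prime to
  \<open>p\<close>.\<close>

lemma sylow_contains_p_elements:
  fixes p r :: nat
  assumes nil: "nilpotent_group G" and fin: "finite (carrier G)"
    and P: "sylow_subgroup p P G" and x: "x \<in> carrier G" and xp: "x [^] (p ^ r) = \<one>"
  shows "x \<in> P"
proof -
  have p: "prime p" and subP: "subgroup P G" and cardP: "card P = p ^ multiplicity p (order G)"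
    using P by (auto simp: sylow_subgroup_def)
  have "x \<in> H" if "subgroup H G" "P \<subseteq> H" "lower_central_series G k \<subseteq> H" for H k
    using that
  proof (induction k arbitrary: H)
    case 0
    then show ?case using x by auto
  next
    case (Suc k)
    let ?K = "normalizer G H"
    let ?GK = "G\<lparr>carrier := ?K\<rparr>"
    have HG: "H \<subseteq> carrier G" using Suc.prems(1) by (rule subgroup.subset)
    have subK: "subgroup ?K G"
      using HG by (rule normalizer_imp_subgroup)
    have normal: "H \<lhd> ?GK"
      using Suc.prems(1) by (rule subgroup_in_normalizer)
    have HK: "H \<subseteq> ?K"
      using subgroup.subset[OF normal_imp_subgroup[OF normal]] by simp
    interpret K: group ?GK using subK by (rule subgroup_imp_group)
    have conj: "g \<otimes> h \<otimes> inv g \<in> H" if g: "g \<in> lower_central_series G k" and h: "h \<in> H" for g h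
    proof -
      have gG: "g \<in> carrier G" and hG: "h \<in> carrier G"
        using g h HG subgroup.mem_carrier[OF lower_central_series_subgroup] by auto
      have "g \<otimes> h \<otimes> inv g \<otimes> inv h \<in> H"
        using commutator_in_lower_central_series[OF g hG] Suc.prems(3) by blast
      then have "g \<otimes> h \<otimes> inv g \<otimes> inv h \<otimes> h \<in> H"
        using h Suc.prems(1) by (simp add: subgroup.m_closed)
      then show ?thesis
        using gG hG by (simp add: m_assoc)
    qed
    have "g \<in> ?K" if g: "g \<in> lower_central_series G k" for g
    proof (rule normalizerI)
      show "g \<in> carrier G"
        using subgroup.mem_carrier[OF lower_central_series_subgroup g] .
      have "inv g \<in> lower_central_series G k"
        using g lower_central_series_subgroup[of k] by (simp add: subgroup.m_inv_closed)
      then show "inv g \<otimes> h \<otimes> g \<in> H" if "h \<in> H" for h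
        using conj[of "inv g" h] that \<open>g \<in> carrier G\<close> by simp
    qed (use conj[OF g] Suc.prems(1) in auto)
    then have xK: "x \<in> ?K"
      using Suc.IH[OF subK] HK Suc.prems(2) by blast
    have "coprime (card (rcosets\<^bsub>?GK\<^esub> H)) p"
    proof (rule ccontr)
      let ?q = "card (rcosets\<^bsub>?GK\<^esub> H)"
      let ?v = "multiplicity p (order G)"
      assume "\<not> coprime ?q p"
      then have "p dvd ?q"
        using p by (metis prime_imp_coprime coprime_commute)
      moreover have "p ^ ?v dvd card H"
      proof -
        have "subgroup P (G\<lparr>carrier := H\<rparr>)"
          using Suc.prems subP by (intro subgroup_incl)
        then have "card P dvd order (G\<lparr>carrier := H\<rparr>)"
          using group.lagrange[OF subgroup_imp_group[OF Suc.prems(1)]] by (metis dvd_triv_right)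
        then show ?thesis by (simp add: cardP order_def)
      qed
      ultimately have "p * p ^ ?v dvd ?q * card H"
        by (rule mult_dvd_mono)
      also have "?q * card H = card ?K"
        using K.lagrange[OF normal_imp_subgroup[OF normal]] by (simp add: order_def)
      also have "card ?K dvd order G"
        using lagrange[OF subK] by (metis dvd_triv_right)
      finally have "p ^ Suc ?v dvd order G" by simp
      moreover have "order G \<noteq> 0"
        using fin order_gt_0_iff_finite by simp
      ultimately have "Suc ?v \<le> ?v"
        using p by (intro multiplicity_geI) auto
      then show False by simp
    qed
    moreover have "x [^]\<^bsub>?GK\<^esub> (p ^ r) = \<one>\<^bsub>?GK\<^esub>"
      using xp by (simp flip: nat_pow_consistent)
    ultimately show ?case
      using K.p_element_in_coprime_normal[OF normal] xK by simp
  qed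
  moreover obtain n where "lower_central_series G n = {\<one>}"
    using nil by (auto simp: nilpotent_group_def)
  ultimately show ?thesis
    using subP subgroup.one_closed[OF subP] by (metis empty_subsetI insert_subset order_refl)
qed

lemma torsion_generator_sylow_iff:
  assumes nil: "nilpotent_group G" and fin: "finite (carrier G)" and P: "sylow_subgroup p P G"
  shows "torsion_generator (G\<lparr>carrier := P\<rparr>) p z \<longleftrightarrow> torsion_generator G p z"
proof -
  have subP: "subgroup P G"
    using P by (simp add: sylow_subgroup_def)
  have inP: "t \<in> P" if "t \<in> carrier G" "t [^] p = \<one>" for t
    using sylow_contains_p_elements[OF nil fin P that(1), of 1] that(2) by simp
  have gen: "generate (G\<lparr>carrier := P\<rparr>) {z} = generate G {z}" if "z \<in> P" for z
    using generate_consistent[OF _ subP, of "{z}"] that by simp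
  show ?thesis
    unfolding torsion_generator_def
    using inP gen subgroup.mem_carrier[OF subP] by (auto simp flip: nat_pow_consistent)
qed

section \<open>The p-groups with a unique subgroup of order p\<close>

lemma ord_prime_power:
  fixes p m :: nat
  assumes p: "prime p" and ordG: "order G = p ^ m" and x: "x \<in> carrier G"
  obtains n where "ord x = p ^ n"
  using ord_dvd_group_order[OF x] p ordG by (metis divides_primepow_nat)

lemma last_power_outside:
  fixes p :: nat
  assumes x: "x \<in> carrier G" "x \<notin> A" and pow: "x [^] (p ^ m) \<in> A"
  obtains i where "x [^] (p ^ i) \<notin> A" and "(x [^] (p ^ i)) [^] p \<in> A"
proof -
  let ?P = "\<lambda>i. x [^] (p ^ i) \<in> A"
  define i where "i = (LEAST i. ?P i)"
  have i: "?P i"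
    using pow unfolding i_def by (rule LeastI)
  have "i \<noteq> 0"
    using i x by (metis nat_pow_eone power_0)
  then obtain j where j: "i = Suc j" by (cases i) auto
  then have "\<not> ?P j"
    using not_less_Least[of j ?P] by (simp add: i_def)
  moreover have "(x [^] (p ^ j)) [^] p \<in> A"
    using i x by (simp add: j nat_pow_pow mult.commute)
  ultimately show ?thesis by (rule that)
qed

text \<open>The subgroup \<open>\<langle>z\<rangle>\<close> competes for the maximum, so the maximal one is not trivial.\<close>

lemma torsion_generator_in_maximal_normal_cyclic:
  fixes p m :: nat
  assumes p: "prime p" and ordG: "order G = p ^ m"
    and z: "torsion_generator G p z" and a: "a \<in> carrier G"
    and max: "\<And>x. x \<in> carrier G \<Longrightarrow> generate G {x} \<lhd> G \<Longrightarrow> ord x \<le> ord a"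
  shows "z \<in> generate G {a}"
proof -
  have zG: "z \<in> carrier G"
    using z by (simp add: torsion_generator_def)
  obtain n where n: "ord a = p ^ n"
    using ord_prime_power[OF p ordG a] .
  have "p \<le> ord a"
    using max[OF zG torsion_generator_normal[OF z]] ord_torsion_generator[OF p z] by simp
  then have "n \<noteq> 0"
    using n prime_gt_1_nat[OF p] by (cases n) auto
  then show ?thesis
    using n p by (intro torsion_generator_mem[OF p z a]) auto
qed

text \<open>Otherwise the centralizer \<open>C\<close> of \<open>a\<close> contains some \<open>b \<notin> \<langle>a\<rangle>\<close> that is central modulo \<open>\<langle>a\<rangle>\<close> and
  satisfies \<open>b ^ p = a ^ s\<close>. If \<open>p\<close> divides \<open>s\<close>, then \<open>a ^ (- s / p) b\<close> is an element of order \<open>p\<close>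
  outside \<open>\<langle>a\<rangle>\<close>; if not, then \<open>\<langle>b\<rangle>\<close> is a normal cyclic subgroup larger than \<open>\<langle>a\<rangle>\<close>.\<close>

lemma maximal_cyclic_normal_self_centralizing:
  fixes p m :: nat
  assumes nil: "nilpotent_group G" and p: "prime p" and ordG: "order G = p ^ m"
    and z: "torsion_generator G p z"
    and a: "a \<in> carrier G" and normal: "generate G {a} \<lhd> G"
    and max: "\<And>x. x \<in> carrier G \<Longrightarrow> generate G {x} \<lhd> G \<Longrightarrow> ord x \<le> ord a"
    and c: "c \<in> carrier G" and ca: "c \<otimes> a = a \<otimes> c"
  shows "c \<in> generate G {a}"
proof -
  let ?A = "generate G {a}"
  have subA: "subgroup ?A G"
    using a by (simp add: generate_is_subgroup)
  have fin: "finite (carrier G)"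
    using ordG p by (metis order_gt_0_iff_finite prime_gt_0_nat zero_less_power)
  obtain n where n: "ord a = p ^ n"
    using ord_prime_power[OF p ordG a] .
  have zA: "z \<in> ?A"
    using torsion_generator_in_maximal_normal_cyclic[OF p ordG z a] max by blast
  show ?thesis
  proof (rule ccontr)
    assume cA: "c \<notin> ?A"
    define C where "C = {x \<in> carrier G. x \<otimes> a = a \<otimes> x}"
    have conj_a: "g \<otimes> a \<otimes> inv g \<in> ?A" if "g \<in> carrier G" for g
      using normal that a by (simp add: normal_inv_iff generate.incl)
    have C_commute: "x \<otimes> y = y \<otimes> x" if "x \<in> C" "y \<in> ?A" for x y
      using that a by (auto simp: C_def mem_generate_singleton_iff commute_int_pow)
    have "C \<lhd> G"
      unfolding normal_inv_iff
    proof (intro conjI ballI)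
      show "subgroup C G"
      proof (rule subgroupI)
        show "C \<noteq> {}" using a by (auto simp: C_def)
        fix x assume x: "x \<in> C"
        then show "inv x \<in> C"
          using commute_int_pow[of x a "- 1"] a by (simp add: C_def int_pow_neg)
        fix y assume y: "y \<in> C"
        have "x \<otimes> y \<otimes> a = x \<otimes> (a \<otimes> y)"
          using x y a by (simp add: C_def m_assoc)
        also have "\<dots> = a \<otimes> (x \<otimes> y)"
          using x y a by (simp add: C_def flip: m_assoc)
        finally show "x \<otimes> y \<in> C"
          using x y by (simp add: C_def)
      qed (auto simp: C_def)
      fix g x assume g: "g \<in> carrier G" and x: "x \<in> C"
      have xG: "x \<in> carrier G" using x by (simp add: C_def)
      define d where "d = inv g \<otimes> a \<otimes> g"
      have d: "d \<in> ?A"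
        using conj_a[of "inv g"] g by (simp add: d_def)
      have dG: "d \<in> carrier G" using g a by (simp add: d_def)
      have a_eq: "a = g \<otimes> d \<otimes> inv g"
        using g a by (simp add: d_def m_assoc cancel_inv)
      have "g \<otimes> x \<otimes> inv g \<otimes> a = g \<otimes> (x \<otimes> d) \<otimes> inv g"
        using g xG dG by (simp add: a_eq m_assoc cancel_inv)
      also have "\<dots> = a \<otimes> (g \<otimes> x \<otimes> inv g)"
        using g xG dG by (simp add: C_commute[OF x d] a_eq m_assoc cancel_inv)
      finally show "g \<otimes> x \<otimes> inv g \<in> C"
        using g xG by (simp add: C_def)
    qed
    moreover have "\<not> C \<subseteq> ?A"
      using c ca cA by (auto simp: C_def)
    ultimately obtain M where M: "subgroup M G" "M \<subseteq> C" "\<not> M \<subseteq> ?A"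
      and comm: "\<And>x g. x \<in> M \<Longrightarrow> g \<in> carrier G \<Longrightarrow> x \<otimes> g \<otimes> inv x \<otimes> inv g \<in> ?A"
      using nilpotent_central_layer[OF nil _ subgroup.one_closed[OF subA]] by blast
    obtain x where x: "x \<in> M" "x \<notin> ?A" using M(3) by blast
    have xG: "x \<in> carrier G"
      using subgroup.mem_carrier[OF M(1) x(1)] .
    have "x [^] (p ^ m) \<in> ?A"
      using pow_order_eq_1[OF xG] subgroup.one_closed[OF subA] by (simp add: ordG)
    then obtain i where i: "x [^] (p ^ i) \<notin> ?A" "(x [^] (p ^ i)) [^] p \<in> ?A"
      using last_power_outside[OF xG x(2)] by blast
    define b where "b = x [^] (p ^ i)"
    have bG: "b \<in> carrier G" using xG by (simp add: b_def)
    have bM: "b \<in> M"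
      using subgroup_int_pow_closed[OF M(1) x(1), of "int (p ^ i)"] by (simp only: b_def int_pow_int)
    then have ba: "b \<otimes> a = a \<otimes> b"
      using M(2) by (auto simp: C_def)
    have bA: "b \<notin> ?A" and "b [^] p \<in> ?A"
      using i by (simp_all add: b_def)
    then obtain s :: int where s: "b [^] p = a [^] s"
      using a mem_generate_singleton_iff by blast
    show False
    proof (cases "int p dvd s")
      case True
      then obtain r where r: "s = int p * r" by (elim dvdE)
      define t where "t = a [^] (- r) \<otimes> b"
      have tG: "t \<in> carrier G" using a bG by (simp add: t_def)
      have "t [^] p = (a [^] (- r)) [^] p \<otimes> b [^] p"
        unfolding t_def using a bG ba by (intro pow_mult_distrib) (simp_all add: commute_int_pow)
      also have "(a [^] (- r)) [^] p = a [^] (- s)"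
        using a by (simp add: r int_pow_pow mult.commute flip: int_pow_int)
      finally have "t [^] p = \<one>"
        using a by (simp add: s flip: int_pow_mult)
      then have "t \<in> generate G {z}"
        using z tG by (simp add: torsion_generator_def)
      then have "t \<in> ?A"
        using generate_singleton_subset[OF a zA] by blast
      moreover have "a [^] r \<in> ?A"
        using a mem_generate_singleton_iff by blast
      ultimately have "a [^] r \<otimes> t \<in> ?A"
        using subA by (simp add: subgroup.m_closed)
      moreover have "a [^] r \<otimes> t = b"
        using a bG by (simp add: t_def int_pow_neg flip: m_assoc)
      ultimately show False using bA by simp
    next
      case False
      then have "coprime s (int (ord a))"
        using p by (simp add: n) (metis prime_imp_coprime coprime_commute prime_nat_int_transfer)
      then have "a \<in> generate G {b [^] p}"
        using coprime_power_generates[OF a] by (simp add: s)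
      moreover have "b [^] p \<in> generate G {b}"
        using bG by (auto simp: mem_generate_singleton_iff simp flip: int_pow_int)
      ultimately have "a \<in> generate G {b}"
        using generate_singleton_subset[OF bG] by blast
      then have AB: "?A \<subseteq> generate G {b}"
        using generate_singleton_subset[OF bG] by blast
      have subB: "subgroup (generate G {b}) G"
        using bG by (simp add: generate_is_subgroup)
      have "generate G {b} \<lhd> G"
      proof (rule generate_singleton_normal[OF bG])
        fix g assume g: "g \<in> carrier G"
        \<comment> \<open>The conjugate of \<open>b\<close> is \<open>[b, g]\<inverse> b\<close>, and the commutator lies in \<open>\<langle>a\<rangle> \<subseteq> \<langle>b\<rangle>\<close>.\<close>
        have "b \<otimes> g \<otimes> inv b \<otimes> inv g \<in> generate G {b}"
          using comm[OF bM g] AB by blast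
        then have "inv (b \<otimes> g \<otimes> inv b \<otimes> inv g) \<otimes> b \<in> generate G {b}"
          by (rule subgroup.m_closed[OF subB subgroup.m_inv_closed[OF subB]]) (simp add: generate.incl)
        then show "g \<otimes> b \<otimes> inv g \<in> generate G {b}"
          using g bG by (simp add: inv_mult_group m_assoc)
      qed
      then have "ord b \<le> ord a"
        using max bG by blast
      then have "card (generate G {b}) \<le> card ?A"
        using a bG by (simp add: generate_pow_card)
      moreover have "finite (generate G {b})"
        using fin subgroup.subset[OF subB] by (rule finite_subset[rotated])
      ultimately have "?A = generate G {b}"
        using AB by (intro card_seteq) auto
      then show False
        using bA by (simp add: generate.incl)
    qed
  qed
qed

text \<open>Let \<open>\<langle>a\<rangle>\<close> be a normal cyclic subgroup of largest order. Every \<open>g\<close> outside \<open>\<langle>a\<rangle>\<close> has its square in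
  \<open>\<langle>a\<rangle>\<close>, and therefore inverts \<open>a\<close>: otherwise the last of the powers \<open>g ^ (2 ^ i)\<close> outside \<open>\<langle>a\<rangle>\<close> is a
  square \<open>d\<^sup>2\<close>, and the exponent \<open>l\<close> by which \<open>d\<close> acts would satisfy \<open>l\<^sup>2 \<equiv> -1\<close> modulo 4. A product
  of two elements that invert \<open>a\<close> centralizes \<open>a\<close>, so \<open>\<langle>a\<rangle>\<close> has only one nontrivial coset.\<close>

lemma unique_prime_subgroup_imp_cyclic_or_quaternion:
  fixes p m :: nat
  assumes nil: "nilpotent_group G" and p: "prime p" and ordG: "order G = p ^ m"
    and z: "torsion_generator G p z"
  shows "cyclic_group G \<or> generalized_quaternion_group G"
proof -
  have fin: "finite (carrier G)"
    using ordG p by (metis order_gt_0_iff_finite prime_gt_0_nat zero_less_power)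
  have "z \<in> carrier G \<and> generate G {z} \<lhd> G"
    using z torsion_generator_normal by (simp add: torsion_generator_def)
  moreover have "\<forall>x. x \<in> carrier G \<and> generate G {x} \<lhd> G \<longrightarrow> ord x < Suc (order G)"
    using fin by (simp add: ord_le_group_order less_Suc_eq_le)
  ultimately obtain a where a: "a \<in> carrier G" and normal: "generate G {a} \<lhd> G"
    and max: "\<And>x. x \<in> carrier G \<Longrightarrow> generate G {x} \<lhd> G \<Longrightarrow> ord x \<le> ord a"
    using ex_has_greatest_nat[of "\<lambda>x. x \<in> carrier G \<and> generate G {x} \<lhd> G" z ord "Suc (order G)"]
    by blast
  let ?A = "generate G {a}"
  have zA: "z \<in> ?A"
    using torsion_generator_in_maximal_normal_cyclic[OF p ordG z a] max by blast
  have self_centralizing: "c \<in> ?A" if "c \<in> carrier G" "c \<otimes> a = a \<otimes> c" for c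
    using maximal_cyclic_normal_self_centralizing[OF nil p ordG z a normal] max that by blast
  have subA: "subgroup ?A G"
    using a by (simp add: generate_is_subgroup)
  obtain n where n: "ord a = p ^ n"
    using ord_prime_power[OF p ordG a] .
  show ?thesis
  proof (cases "carrier G \<subseteq> ?A")
    case True
    then have "carrier G = generate G {a}"
      using subgroup.subset[OF subA] by blast
    also have "\<dots> = range (\<lambda>i::int. a [^] i)"
      by (auto simp: generate_pow[OF a])
    finally have "carrier G = range (\<lambda>i::int. a [^] i)" .
    then show ?thesis
      using a cyclic_group by blast
  next
    case False
    have torsion: "t \<in> ?A" if "t \<in> carrier G" "t [^] p = \<one>" for t
      using that z zA generate_singleton_subset[OF a]
      by (auto simp: torsion_generator_def)
    have inversion: "p = 2" "b \<otimes> a = inv a \<otimes> b" "b [^] (2::nat) = a [^] (2 ^ (n - 1) :: nat)" "n \<ge> 2"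
      if b: "b \<in> carrier G" "b \<notin> ?A" "b [^] p \<in> ?A" for b
    proof -
      have "b \<otimes> a \<otimes> inv b \<in> ?A"
        using normal b a by (simp add: normal_inv_iff generate.incl)
      moreover have "b \<otimes> a \<noteq> a \<otimes> b"
        using self_centralizing b by blast
      ultimately show "p = 2" "b \<otimes> a = inv a \<otimes> b" "b [^] (2::nat) = a [^] (2 ^ (n - 1) :: nat)" "n \<ge> 2"
        using involutive_inversion_outside_cyclic[OF p a b(1) n _ b(2,3)] torsion by blast+
    qed
    have last_power: "\<exists>i. g [^] (p ^ i) \<notin> ?A \<and> (g [^] (p ^ i)) [^] p \<in> ?A"
      if g: "g \<in> carrier G" "g \<notin> ?A" for g
    proof -
      have "g [^] (p ^ m) \<in> ?A"
        using pow_order_eq_1[OF g(1)] subgroup.one_closed[OF subA] by (simp add: ordG)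
      then show ?thesis
        using last_power_outside[OF g] by blast
    qed
    obtain g where "g \<in> carrier G" "g \<notin> ?A" using False by blast
    then obtain b where b: "b \<in> carrier G" "b \<notin> ?A" "b [^] p \<in> ?A"
      using last_power by (metis nat_pow_closed)
    note p2 = inversion(1)[OF b] and ba = inversion(2)[OF b] and b2 = inversion(3)[OF b]
      and n2 = inversion(4)[OF b]
    have square_in: "g [^] (2::nat) \<in> ?A" if g: "g \<in> carrier G" "g \<notin> ?A" for g
    proof -
      obtain i where i: "g [^] (p ^ i) \<notin> ?A" "(g [^] (p ^ i)) [^] p \<in> ?A"
        using last_power[OF g] by blast
      have "i = 0"
      proof (rule ccontr)
        assume "i \<noteq> 0"
        then obtain j where j: "i = Suc j" by (cases i) auto
        define d where "d = g [^] (p ^ j)"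
        have dG: "d \<in> carrier G" using g by (simp add: d_def)
        have d2: "d [^] (2::nat) = g [^] (p ^ i)"
          using g by (simp add: d_def j p2 nat_pow_pow mult.commute)
        have "d \<otimes> a \<otimes> inv d \<in> ?A"
          using normal dG a by (simp add: normal_inv_iff generate.incl)
        then obtain l :: int where "d \<otimes> a \<otimes> inv d = a [^] l"
          using a mem_generate_singleton_iff by blast
        then have da: "d \<otimes> a = a [^] l \<otimes> d"
          using a dG conj_eq_iff[of d a "a [^] l"] by simp
        have "a [^] (l\<^sup>2) \<otimes> d [^] (2::nat) = inv a \<otimes> d [^] (2::nat)"
          using twisted_commute_pow[OF a dG da, of 2 1] inversion(2)[of "d [^] (2::nat)"] i g(1) dG a d2
          by simp
        then have "a [^] (l\<^sup>2) = a [^] (- 1 :: int)"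
          using a dG by (simp add: int_pow_neg)
        then have "int (ord a) dvd l\<^sup>2 + 1"
          using a by (simp only: int_pow_eq) (metis dvd_diff_commute diff_minus_eq_add)
        moreover have "int (2 ^ 2) dvd int (ord a)"
          using n2 unfolding n p2 int_dvd_int_iff by (rule le_imp_power_dvd)
        ultimately have "4 dvd l\<^sup>2 + 1"
          using dvd_trans by fastforce
        then show False
          using not_four_dvd_square_plus_one by blast
      qed
      then show ?thesis
        using i g by (simp add: p2)
    qed
    \<comment> \<open>Here \<open>g b\<close> centralizes \<open>a\<close>, and \<open>g = (g b) (b\<^sup>2)\<inverse> b\<close>.\<close>
    have coset: "\<exists>h \<in> ?A. g = h \<otimes> b" if g: "g \<in> carrier G" "g \<notin> ?A" for g
    proof -
      have ga: "g \<otimes> a = inv a \<otimes> g"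
        using inversion(2)[OF g] square_in[OF g] p2 by simp
      have "g \<otimes> b \<otimes> a = g \<otimes> inv a \<otimes> b"
        using g b a ba by (simp add: m_assoc)
      also have "g \<otimes> inv a = a \<otimes> g"
        using ga g a by (metis inv_closed inv_solve_left inv_solve_right m_assoc m_closed)
      finally have "g \<otimes> b \<otimes> a = a \<otimes> (g \<otimes> b)"
        using g b a by (simp add: m_assoc)
      then have "g \<otimes> b \<in> ?A"
        using self_centralizing g b by blast
      moreover have "inv (b [^] (2::nat)) \<in> ?A"
        using b p2 subA by (simp add: subgroup.m_inv_closed)
      ultimately have "g \<otimes> b \<otimes> inv (b [^] (2::nat)) \<in> ?A"
        using subA by (simp add: subgroup.m_closed)
      moreover have "g = g \<otimes> b \<otimes> inv (b [^] (2::nat)) \<otimes> b"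
        using g b by (simp add: numeral_2_eq_2 inv_mult_group m_assoc)
      ultimately show ?thesis by blast
    qed
    have AG: "?A \<subseteq> carrier G" using subgroup.subset[OF subA] .
    have finA: "finite ?A" using AG fin by (rule finite_subset)
    have carrier: "carrier G = ?A \<union> (\<lambda>h. h \<otimes> b) ` ?A"
      using coset AG b by blast
    have disjoint: "?A \<inter> (\<lambda>h. h \<otimes> b) ` ?A = {}"
    proof -
      have "h \<otimes> b \<notin> ?A" if h: "h \<in> ?A" for h
      proof
        assume "h \<otimes> b \<in> ?A"
        then have "inv h \<otimes> (h \<otimes> b) \<in> ?A"
          using h subA by (simp add: subgroup.m_closed subgroup.m_inv_closed)
        then show False
          using h AG b by (auto simp: subset_iff simp flip: m_assoc)
      qed
      then show ?thesis by blast
    qed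
    have "inj_on (\<lambda>h. h \<otimes> b) ?A"
      using AG b by (auto simp: inj_on_def subset_iff)
    then have "card ((\<lambda>h. h \<otimes> b) ` ?A) = card ?A"
      by (rule card_image)
    then have "order G = card ?A + card ?A"
      unfolding order_def using finA disjoint by (subst carrier) (simp add: card_Un_disjoint)
    also have "card ?A = 2 ^ n"
      using generate_pow_card[OF a] n p2 by simp
    finally have order: "order G = 2 ^ Suc n" by simp
    have "carrier G \<subseteq> generate G {a, b}"
    proof -
      have "?A \<subseteq> generate G {a, b}"
        by (rule mono_generate) auto
      then show ?thesis
        by (subst carrier) (auto intro: generate.eng generate.incl)
    qed
    then have gen: "generate G {a, b} = carrier G"
      using generate_incl[of "{a, b}"] a b by auto
    have "inv b \<otimes> a \<otimes> b = inv a"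
    proof -
      have "b \<otimes> inv a = a \<otimes> b"
        using twisted_commute[OF a b(1), of "- 1" "- 1"] ba a by (simp add: int_pow_neg)
      then have "inv b \<otimes> (a \<otimes> b) = inv b \<otimes> (b \<otimes> inv a)" by simp
      then show ?thesis
        using a b by (simp add: m_assoc[symmetric])
    qed
    moreover have "a [^] (2 ^ (Suc n - 1) :: nat) = \<one>"
      using pow_ord_eq_1[OF a] n p2 by simp
    moreover have "b [^] (2 :: nat) = a [^] (2 ^ (Suc n - 2) :: nat)"
      using b2 n2 by (simp add: numeral_2_eq_2)
    moreover have "3 \<le> Suc n"
      using n2 by simp
    ultimately have "generalized_quaternion_group G"
      unfolding generalized_quaternion_group_def using group_axioms order gen a b(1) by blast
    then show ?thesis ..
  qed
qed

lemma cyclic_p_group_torsion_generator: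
  fixes p m :: nat
  assumes p: "prime p" and ordG: "order G = p ^ m" and m: "m \<noteq> 0" and cyc: "cyclic_group G"
  shows "\<exists>z. torsion_generator G p z"
proof -
  obtain x where x: "x \<in> carrier G" and "carrier G = range (\<lambda>i::int. x [^] i)"
    using cyc cyclic_group by blast
  then have gen: "generate G {x} = carrier G"
    by (auto simp: mem_generate_singleton_iff)
  then have ordx: "ord x = p ^ m"
    using generate_pow_card[OF x] ordG by (simp add: order_def)
  define z where "z = x [^] (p ^ (m - 1))"
  have zG: "z \<in> carrier G" using x by (simp add: z_def)
  have "\<not> p ^ m dvd p ^ (m - 1)"
    using m prime_gt_1_nat[OF p] by (simp add: dvd_power_iff)
  then have "z \<noteq> \<one>"
    using x ordx by (simp add: z_def pow_eq_id)
  moreover have "p ^ (m - 1) * p = p ^ m"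
    using m by (metis power_minus_mult neq0_conv)
  then have "z [^] p = \<one>"
    using x ordx by (simp add: z_def nat_pow_pow pow_eq_id)
  ultimately have "torsion_generator G p z"
    using zG cyclic_torsion_unique[OF p x, of z] by (auto simp: torsion_generator_def gen)
  then show ?thesis ..
qed

text \<open>The relations allow every element to be written as \<open>x ^ i\<close> or \<open>x ^ i y\<close>, so the prescribed order
  forces \<open>x\<close> to have order exactly \<open>2 ^ (n - 1)\<close>. As \<open>(x ^ i y)\<^sup>2 = y\<^sup>2 \<noteq> 1\<close>, all involutions lie in
  \<open>\<langle>x\<rangle>\<close>, where there is only one.\<close>

lemma quaternion_torsion_generator:
  assumes quat: "generalized_quaternion_group G"
  shows "\<exists>z. torsion_generator G 2 z"
proof -
  obtain n x y where n: "n \<ge> 3" and ordG: "order G = 2 ^ n"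
    and x: "x \<in> carrier G" and y: "y \<in> carrier G" and gen: "generate G {x, y} = carrier G"
    and xn: "x [^] (2 ^ (n - 1) :: nat) = \<one>"
    and y2: "y [^] (2 :: nat) = x [^] (2 ^ (n - 2) :: nat)"
    and conj: "inv y \<otimes> x \<otimes> y = inv x"
    using quat by (auto simp: generalized_quaternion_group_def)
  let ?A = "generate G {x}"
  have subA: "subgroup ?A G"
    using x by (simp add: generate_is_subgroup)
  have AG: "?A \<subseteq> carrier G" using subgroup.subset[OF subA] .
  have fin: "finite (carrier G)"
    using ordG by (metis order_gt_0_iff_finite zero_less_power zero_less_numeral)
  have finA: "finite ?A" using AG fin by (rule finite_subset)
  have "y \<otimes> inv x = x \<otimes> y"
    using conj x y by (metis inv_closed inv_solve_left m_assoc m_closed)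
  then have "y \<otimes> x = inv x \<otimes> y"
    using x y by (metis inv_closed inv_solve_left inv_solve_right m_assoc m_closed)
  then have yx: "y \<otimes> x = x [^] (- 1 :: int) \<otimes> y"
    using x by (simp add: int_pow_neg)
  have y_pow: "y \<otimes> x [^] j = x [^] (- j) \<otimes> y" for j :: int
    using twisted_commute[OF x y yx, of j] by simp
  have powA: "x [^] (i::int) \<in> ?A" for i
    using x mem_generate_singleton_iff by blast
  have y2A: "y [^] (2::nat) = x [^] (2 ^ (n - 2) :: int)"
    using y2 int_pow_int[of G x "2 ^ (n - 2)"] by simp
  let ?S = "?A \<union> (\<lambda>h. h \<otimes> y) ` ?A"
  have pow_mult_S: "x [^] i \<otimes> g \<in> ?S" if "g \<in> ?S" for i :: int and g
    using that
  proof
    assume "g \<in> ?A"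
    then show ?thesis
      using powA[of i] subA by (simp add: subgroup.m_closed)
  next
    assume "g \<in> (\<lambda>h. h \<otimes> y) ` ?A"
    then obtain h where h: "h \<in> ?A" "g = h \<otimes> y" by blast
    then have "x [^] i \<otimes> g = (x [^] i \<otimes> h) \<otimes> y"
      using x y AG by (auto simp: m_assoc)
    then show ?thesis
      using powA[of i] h(1) subA by (simp add: subgroup.m_closed)
  qed
  have y_mult_S: "y \<otimes> g \<in> ?S" if "g \<in> ?S" for g
    using that
  proof
    assume "g \<in> ?A"
    then show ?thesis
      using x powA by (auto simp: mem_generate_singleton_iff y_pow)
  next
    assume "g \<in> (\<lambda>h. h \<otimes> y) ` ?A"
    then obtain i :: int where g: "g = x [^] i \<otimes> y"
      using x by (auto simp: mem_generate_singleton_iff)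
    have "y \<otimes> g = x [^] (- i) \<otimes> y [^] (2::nat)"
      using x y y_pow[of i] by (simp add: g numeral_2_eq_2 flip: m_assoc)
    also have "\<dots> \<in> ?A"
      using x powA by (simp add: y2A flip: int_pow_mult)
    finally show ?thesis by simp
  qed
  have inv_y: "inv y = x [^] (- (2 ^ (n - 2)) :: int) \<otimes> y"
  proof -
    have "inv y = inv (y [^] (2::nat)) \<otimes> y"
      using y by (simp add: numeral_2_eq_2 inv_mult_group m_assoc)
    then show ?thesis
      using x by (simp add: y2A int_pow_neg)
  qed
  \<comment> \<open>The set \<open>?S\<close> is stable under left multiplication by the generators and their inverses.\<close>
  have "carrier G \<subseteq> ?S"
  proof
    fix g assume "g \<in> carrier G"
    then have "g \<in> generate G {x, y}" by (simp add: gen)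
    then have "\<forall>s \<in> ?S. g \<otimes> s \<in> ?S"
    proof (induction rule: generate.induct)
      case one
      then show ?case using AG y by auto
    next
      case (incl h)
      then show ?case
        using pow_mult_S[of _ 1] y_mult_S x by auto
    next
      case (inv h)
      then consider "h = x" | "h = y" by blast
      then show ?case
      proof cases
        case 1
        then show ?thesis using pow_mult_S[of _ "- 1"] x by (simp add: int_pow_neg)
      next
        case 2
        have SG: "s \<in> carrier G" if "s \<in> ?S" for s using that AG y by auto
        show ?thesis
        proof
          fix s assume s: "s \<in> ?S"
          have "inv h \<otimes> s = x [^] (- (2 ^ (n - 2)) :: int) \<otimes> (y \<otimes> s)"
            using 2 inv_y x y SG[OF s] by (simp add: m_assoc)
          then show "inv h \<otimes> s \<in> ?S"
            using pow_mult_S y_mult_S s by metis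
        qed
      qed
    next
      case (eng g h)
      have "g \<in> carrier G" "h \<in> carrier G"
        using eng.hyps gen by auto
      moreover have "s \<in> carrier G" if "s \<in> ?S" for s using that AG y by auto
      ultimately show ?case
        using eng.IH by (metis m_assoc)
    qed
    moreover have "\<one> \<in> ?S" using subgroup.one_closed[OF subA] by simp
    ultimately show "g \<in> ?S"
      using \<open>g \<in> carrier G\<close> by (metis r_one)
  qed
  then have "card (carrier G) \<le> card ?S"
    using finA by (intro card_mono) auto
  also have "\<dots> \<le> card ?A + card ((\<lambda>h. h \<otimes> y) ` ?A)"
    by (rule card_Un_le)
  also have "\<dots> \<le> 2 * card ?A"
    using card_image_le[OF finA] by simp
  finally have le: "2 ^ n \<le> 2 * ord x"
    using ordG x by (simp add: order_def generate_pow_card)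
  have n1: "(2::nat) ^ n = 2 * 2 ^ (n - 1)"
    using n by (cases n) auto
  have "ord x dvd 2 ^ (n - 1)"
    using xn by (simp add: pow_eq_id[OF x])
  then have "ord x \<le> 2 ^ (n - 1)"
    by (rule dvd_imp_le) simp
  then have ordx: "ord x = 2 ^ (n - 1)"
    using le n1 by linarith
  define z where "z = x [^] (2 ^ (n - 2) :: nat)"
  have zG: "z \<in> carrier G" using x by (simp add: z_def)
  have zA: "z \<in> ?A"
    using powA[of "int (2 ^ (n - 2))"] by (simp only: z_def int_pow_int)
  have "n - 1 = Suc (n - 2)" using n by simp
  then have n2: "(2::nat) ^ (n - 1) = 2 ^ (n - 2) * 2"
    by simp
  have "\<not> ord x dvd 2 ^ (n - 2)"
    unfolding ordx n2 by (rule nat_dvd_not_less) auto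
  then have z1: "z \<noteq> \<one>"
    using x by (simp add: z_def pow_eq_id)
  have z2: "z [^] (2::nat) = \<one>"
    using x xn[unfolded n2] by (simp add: z_def nat_pow_pow)
  have "t \<in> generate G {z}" if t: "t \<in> carrier G" "t [^] (2::nat) = \<one>" for t
  proof -
    have "t \<in> ?A"
    proof (rule ccontr)
      assume "t \<notin> ?A"
      then obtain h where "h \<in> ?A" "t = h \<otimes> y"
        using \<open>carrier G \<subseteq> ?S\<close> t(1) by blast
      then obtain i :: int where "t = x [^] i \<otimes> y"
        using x by (auto simp: mem_generate_singleton_iff)
      then have "t [^] (2::nat) = z"
        using twisted_pow[OF x y yx, of i 2] x y y2 by (simp add: z_def numeral_2_eq_2)
      then show False using t z1 by simp
    qed
    then show ?thesis
      using cyclic_torsion_unique[OF two_is_prime_nat x zA z1 z2] t by blast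
  qed
  then have "torsion_generator G 2 z"
    using zG z1 z2 by (simp add: torsion_generator_def)
  then show ?thesis ..
qed

section \<open>Dominating vertices of the cyclic graph\<close>

lemma cyclic_pairI:
  assumes x: "x \<in> carrier G" and y: "y \<in> carrier G" and c: "c \<in> carrier G"
    and xc: "x \<in> generate G {c}" and yc: "y \<in> generate G {c}"
    and cxy: "c \<in> generate G {x, y}"
  shows "cyclic_group (subgroup_generated G {x, y})"
proof -
  have "generate G {x, y} = generate G {c}"
  proof
    show "generate G {x, y} \<subseteq> generate G {c}"
      using xc yc c by (intro generate_subgroup_incl generate_is_subgroup) auto
    show "generate G {c} \<subseteq> generate G {x, y}"
      using cxy x y by (intro generate_subgroup_incl generate_is_subgroup) auto
  qed
  then have "subgroup_generated G {x, y} = subgroup_generated G {c}"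
    using x y c by (simp add: subgroup_generated_def Int_absorb1)
  then show ?thesis
    using cyclic_group_generated by simp
qed

lemma cyclic_pairE:
  assumes x: "x \<in> carrier G" and y: "y \<in> carrier G"
    and cyc: "cyclic_group (subgroup_generated G {x, y})"
  obtains c where "c \<in> carrier G" and "x \<in> generate G {c}" and "y \<in> generate G {c}"
proof -
  let ?H = "subgroup_generated G {x, y}"
  have H: "carrier ?H = generate G {x, y}"
    using x y by (simp add: carrier_subgroup_generated Int_absorb1)
  obtain c where cH: "c \<in> carrier ?H" and "carrier ?H = range (\<lambda>i::int. c [^]\<^bsub>?H\<^esub> i)"
    using cyc group.cyclic_group[OF group_subgroup_generated] by blast
  then have range: "carrier ?H = range (\<lambda>i::int. c [^] i)"
    by (simp only: int_pow_subgroup_generated[OF cH])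
  have c: "c \<in> carrier G"
    using cH H generate_incl[of "{x, y}"] x y by auto
  have "carrier ?H = generate G {c}"
    unfolding range by (auto simp: generate_pow[OF c])
  moreover have "x \<in> carrier ?H" "y \<in> carrier ?H"
    by (simp_all add: H generate.incl)
  ultimately show ?thesis
    using that[OF c] by simp
qed

lemma dominatable_cyclic_graph_iff:
  "dominatable (cyclic_graph G) \<longleftrightarrow>
    (\<exists>z \<in> carrier G - {\<one>}. \<forall>x \<in> carrier G - {\<one>}. x \<noteq> z \<longrightarrow> cyclic_group (subgroup_generated G {z, x}))"
  by (auto simp: dominatable_def dominating_vertex_def cyclic_graph_def arcs_ends_def arc_to_ends_def)

text \<open>A power \<open>z\<close> of prime order of the dominating vertex \<open>v\<close> works: it shares a cyclic group with every
  element of order \<open>p\<close>.\<close>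

lemma dominatable_imp_torsion_generator:
  assumes fin: "finite (carrier G)" and dom: "dominatable (cyclic_graph G)"
  shows "\<exists>p z. prime p \<and> torsion_generator G p z"
proof -
  obtain v where v: "v \<in> carrier G" "v \<noteq> \<one>"
    and dom: "\<And>x. x \<in> carrier G \<Longrightarrow> x \<noteq> \<one> \<Longrightarrow> x \<noteq> v \<Longrightarrow> cyclic_group (subgroup_generated G {v, x})"
    using dom unfolding dominatable_cyclic_graph_iff by blast
  have "ord v \<noteq> 1"
    using v ord_eq_1 by blast
  then obtain p where p: "prime p" "p dvd ord v"
    using prime_factor_nat by blast
  have ord0: "ord v \<noteq> 0"
    using ord_ge_1[OF fin v(1)] by simp
  define z where "z = v [^] (ord v div p)"
  have zG: "z \<in> carrier G" using v by (simp add: z_def)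
  have zp: "z [^] p = \<one>"
    using v p by (simp add: z_def nat_pow_pow)
  have "\<not> ord v dvd ord v div p"
    using ord0 p by (auto elim!: dvdE simp: prime_gt_0_nat dest!: dvd_imp_le)
  then have z1: "z \<noteq> \<one>"
    using v by (simp add: z_def pow_eq_id)
  have zv: "z \<in> generate G {v}"
    using v by (auto simp: z_def mem_generate_singleton_iff simp flip: int_pow_int)
  have "t \<in> generate G {z}" if t: "t \<in> carrier G" "t [^] p = \<one>" for t
  proof -
    obtain c where c: "c \<in> carrier G" "v \<in> generate G {c}" "t \<in> generate G {c}"
    proof (cases "t = \<one> \<or> t = v")
      case True
      then have "t \<in> generate G {v}"
        by (auto intro: generate.intros)
      then show ?thesis
        using that v by (blast intro: generate.incl)
    next
      case False
      then show ?thesis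
        using that dom[OF t(1)] cyclic_pairE[OF v(1) t(1)] by blast
    qed
    have "z \<in> generate G {c}"
      using zv generate_singleton_subset[OF c(1,2)] by blast
    then show ?thesis
      using cyclic_torsion_unique[OF p(1) c(1) _ z1 zp c(3) t(2)] by blast
  qed
  then show ?thesis
    using p(1) zG z1 zp by (auto simp: torsion_generator_def)
qed

text \<open>Nilpotency enters through the centrality of \<open>z\<close>, which makes \<open>\<langle>z, x\<rangle>\<close> cyclic when \<open>p\<close> does not divide
  the order of \<open>x\<close>.\<close>

lemma torsion_generator_imp_dominatable:
  assumes nil: "nilpotent_group G" and fin: "finite (carrier G)"
    and p: "prime p" and z: "torsion_generator G p z"
  shows "dominatable (cyclic_graph G)"
proof -
  have zG: "z \<in> carrier G" and z1: "z \<noteq> \<one>" and ordz: "ord z = p"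
    using z ord_torsion_generator[OF p z] by (auto simp: torsion_generator_def)
  have "cyclic_group (subgroup_generated G {z, x})" if x: "x \<in> carrier G" for x
  proof (cases "p dvd ord x")
    case True
    moreover have "ord x \<noteq> 0"
      using ord_ge_1[OF fin x] by simp
    ultimately have "z \<in> generate G {x}"
      using torsion_generator_mem[OF p z x] by blast
    then show ?thesis
      using x zG by (intro cyclic_pairI[of z x x]) (auto intro: generate.incl)
  next
    case False
    define c where "c = z \<otimes> x"
    have cG: "c \<in> carrier G" using zG x by (simp add: c_def)
    have comm: "z \<otimes> x = x \<otimes> z"
      using torsion_generator_central[OF nil p z x] by simp
    have "c [^] ord x = z [^] ord x"
      unfolding c_def using zG x comm by (simp add: pow_mult_distrib)
    then have c_pow: "c [^] int (ord x) = z [^] int (ord x)"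
      by (simp only: int_pow_int)
    have "coprime (int (ord x)) (int (ord z))"
      using False p ordz by (metis prime_imp_coprime coprime_commute coprime_int_iff)
    then have "z \<in> generate G {c [^] int (ord x)}"
      using coprime_power_generates[OF zG] by (simp only: c_pow)
    moreover have "c [^] int (ord x) \<in> generate G {c}"
      using cG mem_generate_singleton_iff by blast
    ultimately have zc: "z \<in> generate G {c}"
      using generate_singleton_subset[OF cG] by blast
    have sub: "subgroup (generate G {c}) G"
      using cG by (simp add: generate_is_subgroup)
    have "inv z \<otimes> c \<in> generate G {c}"
      by (rule subgroup.m_closed[OF sub subgroup.m_inv_closed[OF sub zc]]) (simp add: generate.incl)
    then have xc: "x \<in> generate G {c}"
      using zG x by (simp add: c_def cancel_inv)
    have "c \<in> generate G {z, x}"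
      unfolding c_def by (intro generate.eng generate.incl) auto
    then show ?thesis
      by (rule cyclic_pairI[OF zG x cG zc xc])
  qed
  then show ?thesis
    unfolding dominatable_cyclic_graph_iff using zG z1 by blast
qed

end

theorem corollary5:
  fixes G :: "('a, 'b) monoid_scheme"
  assumes "nilpotent_group G" and "finite (carrier G)"
  shows "dominatable (cyclic_graph G) \<longleftrightarrow>
    (\<exists>p P. prime p \<and> p dvd order G \<and> sylow_subgroup p P G \<and>
      (cyclic_group (G\<lparr>carrier := P\<rparr>) \<or> generalized_quaternion_group (G\<lparr>carrier := P\<rparr>)))"
    (is "_ \<longleftrightarrow> ?sylow")
proof
  interpret group G
    using assms(1) by (simp add: nilpotent_group_def)
  have order0: "order G \<noteq> 0"
    using assms(2) order_gt_0_iff_finite by simp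
  show ?sylow if dom: "dominatable (cyclic_graph G)"
  proof -
    obtain p z where p: "prime p" and z: "torsion_generator G p z"
      using dominatable_imp_torsion_generator[OF assms(2) dom] by blast
    have "p dvd order G"
      using ord_dvd_group_order ord_torsion_generator[OF p z] z by (auto simp: torsion_generator_def)
    obtain m where "order G = p ^ multiplicity p (order G) * m"
      using multiplicity_dvd[of p "order G"] by (metis dvdE)
    then obtain P where P: "sylow_subgroup p P G"
      using sylow_thm[OF p group_axioms _ assms(2)] p by (auto simp: sylow_subgroup_def)
    then have subP: "subgroup P G" and cardP: "card P = p ^ multiplicity p (order G)"
      by (simp_all add: sylow_subgroup_def)
    interpret P: group "G\<lparr>carrier := P\<rparr>"
      using subP by (rule subgroup_imp_group)
    have "torsion_generator (G\<lparr>carrier := P\<rparr>) p z"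
      using z torsion_generator_sylow_iff[OF assms P] by blast
    moreover have "order (G\<lparr>carrier := P\<rparr>) = p ^ multiplicity p (order G)"
      using cardP by (simp add: order_def)
    ultimately have "cyclic_group (G\<lparr>carrier := P\<rparr>) \<or> generalized_quaternion_group (G\<lparr>carrier := P\<rparr>)"
      using P.unique_prime_subgroup_imp_cyclic_or_quaternion[OF subgroup_nilpotent[OF assms(1) subP] p]
      by blast
    then show ?thesis
      using p \<open>p dvd order G\<close> P by blast
  qed
  show "dominatable (cyclic_graph G)" if sylow: ?sylow
  proof -
    obtain p P where p: "prime p" "p dvd order G" and P: "sylow_subgroup p P G"
      and type: "cyclic_group (G\<lparr>carrier := P\<rparr>) \<or> generalized_quaternion_group (G\<lparr>carrier := P\<rparr>)"
      using sylow by blast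
    have subP: "subgroup P G" and cardP: "order (G\<lparr>carrier := P\<rparr>) = p ^ multiplicity p (order G)"
      using P by (simp_all add: sylow_subgroup_def order_def)
    interpret P: group "G\<lparr>carrier := P\<rparr>"
      using subP by (rule subgroup_imp_group)
    have v: "multiplicity p (order G) \<noteq> 0"
      using p order0 prime_elem_multiplicity_eq_zero_iff[OF prime_imp_prime_elem] by blast
    have "\<exists>z. torsion_generator (G\<lparr>carrier := P\<rparr>) p z"
      using type
    proof
      assume "cyclic_group (G\<lparr>carrier := P\<rparr>)"
      then show ?thesis
        using P.cyclic_p_group_torsion_generator[OF p(1) cardP v] by blast
    next
      assume quat: "generalized_quaternion_group (G\<lparr>carrier := P\<rparr>)"
      then obtain n where "n \<ge> 3" "p ^ multiplicity p (order G) = 2 ^ n"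
        using cardP by (auto simp: generalized_quaternion_group_def)
      then have "p = 2"
        using prime_power_inj'(1)[OF p(1) two_is_prime_nat] v by auto
      then show ?thesis
        using P.quaternion_torsion_generator[OF quat] by simp
    qed
    then show ?thesis
      using torsion_generator_sylow_iff[OF assms P] torsion_generator_imp_dominatable[OF assms p(1)]
      by blast
  qed
qed

end
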